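(* There is a polynomial-time algorithm which, given a digraph $D=(V,A)$ with $|V|\ge 2$ and a positive integer $k$, outputs a subpartition $\mathcal{X}$ of $V$ with $|\mathcal{X}|\ge 2$ that maximizes $\sum_{X\in\mathcal{X}}(k-\varrho_D(X))$ among all subpartitions of $V$ with at least two members.
   Context: $\varrho_D(Z)$ is the number of arcs of $D$ entering $Z$. A subpartition of $V$ is a collection of pairwise disjoint non-empty subsets of $V$. *)

theory Defs
  imports
    "Graph_Theory.Digraph"
    "HOL-Library.Disjoint_Sets"
    "HOL-Computational_Algebra.Polynomial"
begin

section \<open>Model of computation\<close>

text \<open>
  Algorithms are programs of a WHILE language over binary trees, as in Jones, \<^emph>\<open>Computability and
  Complexity from a Programming Perspective\<close>. A program has finitely many variables, its data are
  finite trees, and its only primitive operations build a node, take one apart, and test for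
  the leaf.

  The cost is of logarithmic type: evaluating an expression costs, for every subexpression,
  one plus the size of its value. Hence no value, intermediate ones included, is larger than
  the time spent on it, and a multitape Turing machine simulates a run with polynomial
  overhead (and conversely).
\<close>

datatype data = Leaf | Node data data

fun left :: "data \<Rightarrow> data" where
  "left Leaf = Leaf"
| "left (Node a b) = a"

fun right :: "data \<Rightarrow> data" where
  "right Leaf = Leaf"
| "right (Node a b) = b"

type_synonym state = "nat \<Rightarrow> data"

datatype exp = Var nat | LeafE | NodeE exp exp | LeftE exp | RightE exp

fun val :: "exp \<Rightarrow> state \<Rightarrow> data" where
  "val (Var x) s = s x"
| "val LeafE s = Leaf"
| "val (NodeE e f) s = Node (val e s) (val f s)"
| "val (LeftE e) s = left (val e s)"
| "val (RightE e) s = right (val e s)"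

text \<open>On \<^typ>\<open>data\<close>, the function \<^const>\<open>size\<close> counts the occurrences of \<^const>\<open>Node\<close>.\<close>

fun exp_time :: "exp \<Rightarrow> state \<Rightarrow> nat" where
  "exp_time (Var x) s = 1 + size (s x)"
| "exp_time LeafE s = 1"
| "exp_time (NodeE e f) s = exp_time e s + exp_time f s + 1 + size (val (NodeE e f) s)"
| "exp_time (LeftE e) s = exp_time e s + 1 + size (val (LeftE e) s)"
| "exp_time (RightE e) s = exp_time e s + 1 + size (val (RightE e) s)"

datatype com =
    Skip
  | Assign nat exp
  | Seq com com
  | If exp com com
  | While exp com

text \<open>\<open>exec c s t s'\<close>: started in \<open>s\<close>, the program \<open>c\<close> halts in \<open>s'\<close> after time \<open>t\<close>.
  In tests, \<^const>\<open>Leaf\<close> means false and every other tree means true.\<close>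

inductive exec :: "com \<Rightarrow> state \<Rightarrow> nat \<Rightarrow> state \<Rightarrow> bool" where
  Skip: "exec Skip s 1 s"
| Assign: "exec (Assign x e) s (1 + exp_time e s) (s(x := val e s))"
| Seq: "exec c s t s' \<Longrightarrow> exec d s' u s'' \<Longrightarrow> exec (Seq c d) s (1 + t + u) s''"
| IfTrue: "val e s \<noteq> Leaf \<Longrightarrow> exec c s t s' \<Longrightarrow> exec (If e c d) s (1 + exp_time e s + t) s'"
| IfFalse: "val e s = Leaf \<Longrightarrow> exec d s t s' \<Longrightarrow> exec (If e c d) s (1 + exp_time e s + t) s'"
| WhileFalse: "val e s = Leaf \<Longrightarrow> exec (While e c) s (1 + exp_time e s) s"
| WhileTrue: "val e s \<noteq> Leaf \<Longrightarrow> exec c s t s' \<Longrightarrow> exec (While e c) s' u s'' \<Longrightarrow>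
    exec (While e c) s (1 + exp_time e s + t + u) s''"

inductive_cases exec_cases:
  "exec Skip s t s'" "exec (Assign x e) s t s'" "exec (Seq c d) s t s'"
  "exec (If e c d) s t s'" "exec (While e c) s t s'"

lemma exec_deterministic: "exec c s t s' \<Longrightarrow> exec c s u s'' \<Longrightarrow> u = t \<and> s'' = s'"
proof (induction arbitrary: u s'' rule: exec.induct)
  case (Skip s)
  then show ?case by (rule exec_cases(1)) simp
next
  case (Assign x e s)
  then show ?case by (rule exec_cases(2)) simp
next
  case (Seq c s t s' d u' s1)
  from Seq.prems obtain t1 r u1 where r: "exec c s t1 r" "exec d r u1 s''" "u = 1 + t1 + u1"
    by (rule exec_cases(3)) auto
  from Seq.IH(1)[OF r(1)] have "t1 = t" "r = s'" by auto
  with Seq.IH(2)[of u1 s''] r show ?case by simp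
next
  case (IfTrue e s c t s' d)
  from IfTrue.prems IfTrue.hyps obtain t1 where r: "exec c s t1 s''" "u = 1 + exp_time e s + t1"
    by (cases rule: exec_cases(4)) auto
  with IfTrue.IH[OF r(1)] show ?case by simp
next
  case (IfFalse e s d t s' c)
  from IfFalse.prems IfFalse.hyps obtain t1 where r: "exec d s t1 s''" "u = 1 + exp_time e s + t1"
    by (cases rule: exec_cases(4)) auto
  with IfFalse.IH[OF r(1)] show ?case by simp
next
  case (WhileFalse e s c)
  from WhileFalse.prems WhileFalse.hyps show ?case by (cases rule: exec_cases(5)) auto
next
  case (WhileTrue e s c t s' u' s1)
  from WhileTrue.prems WhileTrue.hyps obtain t1 r u1 where
    r: "exec c s t1 r" "exec (While e c) r u1 s''" "u = 1 + exp_time e s + t1 + u1"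
    by (cases rule: exec_cases(5)) auto
  from WhileTrue.IH(1)[OF r(1)] have "t1 = t" "r = s'" by auto
  with WhileTrue.IH(2)[of u1 s''] r show ?case by simp
qed

text \<open>Input and output are passed in variable \<open>0\<close>.\<close>

definition computes_within :: "com \<Rightarrow> data \<Rightarrow> nat \<Rightarrow> data \<Rightarrow> bool" where
  "computes_within c x t y \<longleftrightarrow>
    (\<exists>u s. exec c ((\<lambda>_. Leaf)(0 := x)) u s \<and> u \<le> t \<and> y = s 0)"

section \<open>Encodings\<close>

text \<open>Numbers are in binary, least significant bit first.\<close>

fun enc_nat :: "nat \<Rightarrow> data" where
  "enc_nat n = (if n = 0 then Leaf
     else Node (if even n then Leaf else Node Leaf Leaf) (enc_nat (n div 2)))"

declare enc_nat.simps [simp del]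

fun enc_list :: "('a \<Rightarrow> data) \<Rightarrow> 'a list \<Rightarrow> data" where
  "enc_list f [] = Leaf"
| "enc_list f (x # xs) = Node (f x) (enc_list f xs)"

fun enc_pair :: "('a \<Rightarrow> data) \<Rightarrow> ('b \<Rightarrow> data) \<Rightarrow> 'a \<times> 'b \<Rightarrow> data" where
  "enc_pair f g (x, y) = Node (f x) (g y)"

lemma enc_nat_inj: "enc_nat m = enc_nat n \<Longrightarrow> m = n"
proof (induction m arbitrary: n rule: less_induct)
  case (less m)
  show ?case
  proof (cases "m = 0 \<or> n = 0")
    case True
    then show ?thesis
      using less.prems enc_nat.simps[of m] enc_nat.simps[of n] by (auto split: if_splits)
  next
    case False
    then have "even m = even n" "enc_nat (m div 2) = enc_nat (n div 2)"
      using less.prems enc_nat.simps[of m] enc_nat.simps[of n] by (auto split: if_splits)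
    moreover from this have "m div 2 = n div 2"
      using less.IH[of "m div 2"] False by simp
    ultimately show ?thesis
      by (metis even_two_times_div_two odd_two_times_div_two_succ)
  qed
qed

lemma enc_list_inj: "(\<And>x y. f x = f y \<Longrightarrow> x = y) \<Longrightarrow> enc_list f xs = enc_list f ys \<Longrightarrow> xs = ys"
proof (induction xs arbitrary: ys)
  case Nil
  then show ?case by (cases ys) auto
next
  case (Cons x xs)
  then show ?case by (cases ys) auto
qed

text \<open>
  The vertices are listed in an arbitrary order, and so are the arcs, each by its tail and head.
  Parallel arcs thus show up as repeated entries of the second list.
\<close>

definition encodes_instance :: "(nat, nat) pre_digraph \<Rightarrow> nat \<Rightarrow> data \<Rightarrow> bool" where
  "encodes_instance D k x \<longleftrightarrow> (\<exists>vs es.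
     distinct vs \<and> set vs = verts D \<and> distinct es \<and> set es = arcs D \<and>
     x = enc_pair (enc_list enc_nat) (enc_pair (enc_list (enc_pair enc_nat enc_nat)) enc_nat)
           (vs, map (arc_to_ends D) es, k))"

definition encodes_family :: "nat set set \<Rightarrow> data \<Rightarrow> bool" where
  "encodes_family \<X> y \<longleftrightarrow> (\<exists>Xs.
     distinct (map set Xs) \<and> (\<forall>X \<in> set Xs. distinct X) \<and> set (map set Xs) = \<X> \<and>
     y = enc_list (enc_list enc_nat) Xs)"

lemma encodes_family_unique: "encodes_family \<X> y \<Longrightarrow> encodes_family \<Y> y \<Longrightarrow> \<X> = \<Y>"
  unfolding encodes_family_def by (metis enc_list_inj enc_nat_inj)

section \<open>Subpartitions\<close>

definition in_deg :: "('a, 'b) pre_digraph \<Rightarrow> 'a set \<Rightarrow> nat" where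
  "in_deg D Z = card {e \<in> arcs D. tail D e \<notin> Z \<and> head D e \<in> Z}"

definition subpartition :: "'a set \<Rightarrow> 'a set set \<Rightarrow> bool" where
  "subpartition V \<X> \<longleftrightarrow> (\<forall>X \<in> \<X>. X \<subseteq> V \<and> X \<noteq> {}) \<and> disjoint \<X>"

definition deficiency :: "('a, 'b) pre_digraph \<Rightarrow> nat \<Rightarrow> 'a set set \<Rightarrow> int" where
  "deficiency D k \<X> = (\<Sum>X \<in> \<X>. int k - int (in_deg D X))"

definition optimal_subpartition :: "('a, 'b) pre_digraph \<Rightarrow> nat \<Rightarrow> 'a set set \<Rightarrow> bool" where
  "optimal_subpartition D k \<X> \<longleftrightarrow>
     subpartition (verts D) \<X> \<and> card \<X> \<ge> 2 \<and>
     (\<forall>\<Y>. subpartition (verts D) \<Y> \<and> card \<Y> \<ge> 2 \<longrightarrow> deficiency D k \<Y> \<le> deficiency D k \<X>)"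

end

theory Submission
  imports Defs
begin

text \<open>
  Let \<open>r\<close> and \<open>s\<close> lie in different members of the subpartition, and let \<open>R\<close> be the member containing \<open>r\<close>.
  After lowering the cost \<open>\<rho>(X) - k\<close> of singletons other than \<open>{s}\<close> to at most \<open>0\<close>, the other members
  extend to a partition of \<open>V - R\<close>, and the cost is still intersecting submodular. So the minimum cost
  \<open>q(Z)\<close> of a partition of \<open>Z\<close> (a Dilworth truncation) is found greedily, by one submodular
  minimization for each vertex of \<open>Z\<close>, and the greedy solution also shows that \<open>q\<close> is submodular. Hence
  \<open>\<rho>(R) - k + q(V - R)\<close> is submodular in \<open>R\<close>, and is minimized over \<open>r \<in> R\<close>, \<open>s \<notin> R\<close>; all pairs \<open>r\<close>, \<open>s\<close>
  are tried.

  All values are of polynomial size once \<open>k\<close> is capped by the number of arcs plus one, so a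
  pseudopolynomial submodular minimization suffices: projected subgradient descent on the Lovasz
  extension, with integer points.
\<close>

section \<open>Encodings by type\<close>

text \<open>The requirement of two members is the obstacle: a Dilworth truncation cannot express it,
  since the partition into a single block may win. Prescribing \<open>r \<in> R\<close> and
  \<open>s \<notin> R\<close> enforces it. This is also why \<open>{s}\<close> is exempt from the
  lowering: singletons that were only counted with cost 0 are discarded at the end, whereas the
  block of \<open>s\<close> always survives next to \<open>R\<close>. The lowering can break the
  submodular inequality for disjoint sets, so the weaker intersecting version has to carry the whole
  argument.

  The running time is treated compositionally: the algorithm is a HOL function on lists, built from
  operations under which a class of polynomial-time functions is closed. The delicate operation is
  the loop. This shapes the algorithm: some values are clamped to a range that they provably never
  leave, merely to make such a bound visible.\<close>

class encodable =
  fixes encode :: "'a \<Rightarrow> data"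

instantiation unit :: encodable
begin
definition encode_unit :: "unit \<Rightarrow> data" where "encode_unit u = Leaf"
instance ..
end

instantiation bool :: encodable
begin
definition encode_bool :: "bool \<Rightarrow> data" where "encode_bool b = (if b then Node Leaf Leaf else Leaf)"
instance ..
end

instantiation nat :: encodable
begin
definition encode_nat :: "nat \<Rightarrow> data" where "encode_nat = enc_nat"
instance ..
end

instantiation prod :: (encodable, encodable) encodable
begin
definition encode_prod :: "'a \<times> 'b \<Rightarrow> data" where "encode_prod = enc_pair encode encode"
instance ..
end

instantiation list :: (encodable) encodable
begin
definition encode_list :: "'a list \<Rightarrow> data" where "encode_list = enc_list encode"
instance ..
end

text \<open>The naturals are the vertices and the input \<open>k\<close>, in binary as in the input; the integers are the
  numbers computed with, which are small, so that unary encoding does.\<close>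

instantiation int :: encodable
begin
definition encode_int :: "int \<Rightarrow> data" where
  "encode_int i = encode (replicate (nat i) (), replicate (nat (- i)) ())"
instance ..
end

abbreviation esize :: "'a::encodable \<Rightarrow> nat" where
  "esize x \<equiv> size (encode x)"

lemma encode_simps [simp]:
  "encode () = Leaf"
  "encode True = Node Leaf Leaf"
  "encode False = Leaf"
  "encode (x, y) = Node (encode x) (encode y)"
  "encode [] = Leaf"
  "encode (z # zs) = Node (encode z) (encode zs)"
  by (simp_all add: encode_unit_def encode_bool_def encode_prod_def encode_list_def)

lemma encode_bool_Leaf_iff [simp]: "encode b = Leaf \<longleftrightarrow> \<not> b"
  by (cases b) auto

lemma encode_list_Leaf_iff [simp]: "encode xs = Leaf \<longleftrightarrow> xs = []"
  by (cases xs) auto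

lemma esize_replicate_unit [simp]: "esize (replicate n ()) = n"
  by (induction n) auto

lemma esize_int: "esize (i :: int) = Suc (nat \<bar>i\<bar>)"
  by (auto simp: encode_int_def)

lemma esize_append: "esize (xs @ ys) = esize xs + esize ys"
  by (induction xs) auto

lemma length_le_esize: "length xs \<le> esize xs"
  by (induction xs) auto

lemma esize_le_list: "x \<in> set xs \<Longrightarrow> esize x < esize xs"
  by (induction xs) auto

lemma esize_take: "esize (take n xs) \<le> esize xs"
  by (metis append_take_drop_id esize_append le_add1)

lemma esize_drop: "esize (drop n xs) \<le> esize xs"
  by (metis append_take_drop_id esize_append le_add2)

section \<open>Programs\<close>

text \<open>Only assigned variables count, not those which are merely read.\<close>

fun var_bound :: "com \<Rightarrow> nat" where
  "var_bound Skip = 1"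
| "var_bound (Assign x e) = Suc x"
| "var_bound (Seq c d) = max (var_bound c) (var_bound d)"
| "var_bound (If e c d) = max (var_bound c) (var_bound d)"
| "var_bound (While e c) = var_bound c"

lemma exec_frame: "exec c s t s' \<Longrightarrow> var_bound c \<le> x \<Longrightarrow> s' x = s x"
  by (induction rule: exec.induct) auto

lemma size_val_le: "size (val e s) \<le> exp_time e s"
  by (cases e) auto

text \<open>The cost of an expression includes the size of its value, so nothing can grow faster
  than the clock.\<close>

lemma exec_size: "exec c s t s' \<Longrightarrow> size (s' x) \<le> size (s x) + t"
  by (induction rule: exec.induct) (auto intro: le_trans[OF size_val_le])

lemma poly_mono_nat: "a \<le> b \<Longrightarrow> poly p a \<le> poly (p :: nat poly) b"
  by (induction p) (auto intro: add_mono mult_mono)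

section \<open>Polynomial bounds\<close>

definition poly_bounded :: "('a::encodable \<Rightarrow> nat) \<Rightarrow> bool" where
  "poly_bounded f \<longleftrightarrow> (\<exists>p. \<forall>x. f x \<le> poly p (esize x))"

lemma poly_boundedI: "(\<And>x. f x \<le> poly p (esize x)) \<Longrightarrow> poly_bounded f"
  by (auto simp: poly_bounded_def)

lemma poly_bounded_const: "poly_bounded (\<lambda>x. c)"
  by (rule poly_boundedI[of _ "[:c:]"]) simp

lemma poly_bounded_esize: "poly_bounded esize"
  by (rule poly_boundedI[of _ "[:0, 1:]"]) simp

lemma poly_bounded_add: "poly_bounded f \<Longrightarrow> poly_bounded g \<Longrightarrow> poly_bounded (\<lambda>x. f x + g x)"
  unfolding poly_bounded_def by (metis add_mono poly_add)

lemma poly_bounded_mult: "poly_bounded f \<Longrightarrow> poly_bounded g \<Longrightarrow> poly_bounded (\<lambda>x. f x * g x)"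
  unfolding poly_bounded_def by (metis mult_mono le0 poly_mult)

lemma poly_bounded_poly: "poly_bounded f \<Longrightarrow> poly_bounded (\<lambda>x. poly q (f x))"
  unfolding poly_bounded_def by (metis poly_mono_nat poly_pcompose)

lemma poly_bounded_mono: "poly_bounded g \<Longrightarrow> (\<And>x. f x \<le> g x) \<Longrightarrow> poly_bounded f"
  unfolding poly_bounded_def by (meson le_trans)

lemmas poly_bounded_intros =
  poly_bounded_const poly_bounded_esize poly_bounded_add poly_bounded_mult poly_bounded_poly

text \<open>The class FP. Programs may be started with arbitrary data in the variables other than \<open>0\<close>, so that they
  can be composed without cleaning up.\<close>

definition fp :: "('a::encodable \<Rightarrow> 'b::encodable) \<Rightarrow> bool" where
  "fp f \<longleftrightarrow> (\<exists>c p. \<forall>s x. s 0 = encode x \<longrightarrow>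
     (\<exists>t s'. exec c s t s' \<and> t \<le> poly p (esize x) \<and> s' 0 = encode (f x)))"

lemma fpE:
  assumes "fp f"
  obtains c p where
    "\<And>s x. s 0 = encode x \<Longrightarrow> \<exists>t s'. exec c s t s' \<and> t \<le> poly p (esize x) \<and> s' 0 = encode (f x)"
  using assms unfolding fp_def by blast

lemma fpI:
  assumes "\<And>s x. s 0 = encode x \<Longrightarrow> \<exists>t s'. exec c s t s' \<and> t \<le> b x \<and> s' 0 = encode (f x)"
    and "poly_bounded b"
  shows "fp f"
  using assms unfolding fp_def poly_bounded_def by (meson le_trans)

text \<open>Needed whenever programs are chained: the time bound of the second is a polynomial in
  the size of the intermediate result, which must in turn be polynomial in the input.\<close>

lemma fp_esize: "fp f \<Longrightarrow> poly_bounded (\<lambda>x. esize (f x))"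
proof (erule fpE)
  fix c p
  assume *: "\<And>s x. s 0 = encode x \<Longrightarrow> \<exists>t s'. exec c s t s' \<and> t \<le> poly p (esize x) \<and> s' 0 = encode (f x)"
  have "esize (f x) \<le> esize x + poly p (esize x)" for x
    using *[of "\<lambda>_. encode x" x] exec_size[of c "\<lambda>_. encode x" _ _ 0] by fastforce
  then show ?thesis
    by (rule poly_bounded_mono[rotated]) (intro poly_bounded_intros)
qed

section \<open>Closure properties of FP\<close>

lemma exec_AssignI:
  "t = 1 + exp_time e s \<Longrightarrow> v = val e s \<Longrightarrow> exec (Assign x e) s t (s(x := v))"
  using exec.Assign by simp

text \<open>The empty program does it. A change of type that keeps the underlying tree is therefore
  free: a pair becomes a nonempty list, a number its list of bits, an integer its pair of unary
  parts.\<close>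

lemma fp_recode: "(\<And>x. encode (f x) = encode x) \<Longrightarrow> fp f"
  by (rule fpI[of Skip "\<lambda>_. 1"]) (metis exec.Skip order_refl, rule poly_bounded_const)

lemma fp_id: "fp (\<lambda>x. x)"
  by (rule fp_recode) simp

fun quote :: "data \<Rightarrow> exp" where
  "quote Leaf = LeafE"
| "quote (Node a b) = NodeE (quote a) (quote b)"

lemma val_quote [simp]: "val (quote d) s = d"
  by (induction d) auto

lemma exp_time_quote: "exp_time (quote d) s = exp_time (quote d) s'"
  by (induction d) auto

lemma fp_const: "fp (\<lambda>x. y)"
proof (rule fpI[of "Assign 0 (quote (encode y))" "\<lambda>x. 1 + exp_time (quote (encode y)) (\<lambda>_. Leaf)"])
  fix s :: state and x
  have "exec (Assign 0 (quote (encode y))) s (1 + exp_time (quote (encode y)) (\<lambda>_. Leaf))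
     (s(0 := encode y))"
    using exec.Assign[of 0 "quote (encode y)" s] exp_time_quote[of "encode y" s "\<lambda>_. Leaf"] by simp
  then show "\<exists>t s'. exec (Assign 0 (quote (encode y))) s t s' \<and>
    t \<le> 1 + exp_time (quote (encode y)) (\<lambda>_. Leaf) \<and> s' 0 = encode y"
    by fastforce
qed (intro poly_bounded_intros)

lemma fp_comp:
  fixes f :: "'a::encodable \<Rightarrow> 'b::encodable"
  assumes "fp g" "fp f"
  shows "fp (\<lambda>x. g (f x))"
proof -
  obtain c p where c: "\<And>s x. s 0 = encode x \<Longrightarrow>
      \<exists>t s'. exec c s t s' \<and> t \<le> poly p (esize x) \<and> s' 0 = encode (f x)"
    using assms(2) by (rule fpE) blast
  obtain d q where d: "\<And>s x. s 0 = encode x \<Longrightarrow>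
      \<exists>t s'. exec d s t s' \<and> t \<le> poly q (esize x) \<and> s' 0 = encode (g x)"
    using assms(1) by (rule fpE) blast
  show ?thesis
  proof (rule fpI[of "Seq c d" "\<lambda>x. 1 + poly p (esize x) + poly q (esize (f x))"])
    fix s :: state and x :: 'a
    assume "s 0 = encode x"
    then obtain t s' where 1: "exec c s t s'" "t \<le> poly p (esize x)" "s' 0 = encode (f x)"
      using c by blast
    obtain u s'' where 2: "exec d s' u s''" "u \<le> poly q (esize (f x))" "s'' 0 = encode (g (f x))"
      using d[of s' "f x"] 1(3) by blast
    show "\<exists>t s'. exec (Seq c d) s t s' \<and>
        t \<le> 1 + poly p (esize x) + poly q (esize (f x)) \<and> s' 0 = encode (g (f x))"
      using exec.Seq[OF 1(1) 2(1)] 1(2) 2(2,3) by fastforce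
  qed (intro poly_bounded_intros fp_esize assms)
qed

lemma fp_fst:
  fixes f :: "'a::encodable \<Rightarrow> 'b::encodable \<times> 'c::encodable"
  assumes "fp f"
  shows "fp (\<lambda>x. fst (f x))"
proof (rule fp_comp[OF _ assms])
  show "fp (fst :: 'b \<times> 'c \<Rightarrow> 'b)"
  proof (rule fpI[of "Assign 0 (LeftE (Var 0))" "\<lambda>x. 3 + esize x + esize x"])
    fix s :: state and x :: "'b \<times> 'c"
    assume "s 0 = encode x"
    then show "\<exists>t s'. exec (Assign 0 (LeftE (Var 0))) s t s' \<and> t \<le> 3 + esize x + esize x \<and>
        s' 0 = encode (fst x)"
      using exec.Assign[of 0 "LeftE (Var 0)" s] by (cases x) fastforce
  qed (intro poly_bounded_intros)
qed

lemma fp_snd: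
  fixes f :: "'a::encodable \<Rightarrow> 'b::encodable \<times> 'c::encodable"
  assumes "fp f"
  shows "fp (\<lambda>x. snd (f x))"
proof (rule fp_comp[OF _ assms])
  show "fp (snd :: 'b \<times> 'c \<Rightarrow> 'c)"
  proof (rule fpI[of "Assign 0 (RightE (Var 0))" "\<lambda>x. 3 + esize x + esize x"])
    fix s :: state and x :: "'b \<times> 'c"
    assume "s 0 = encode x"
    then show "\<exists>t s'. exec (Assign 0 (RightE (Var 0))) s t s' \<and> t \<le> 3 + esize x + esize x \<and>
        s' 0 = encode (snd x)"
      using exec.Assign[of 0 "RightE (Var 0)" s] by (cases x) fastforce
  qed (intro poly_bounded_intros)
qed

text \<open>A copy of the input is kept in a variable which neither program touches.\<close>

lemma fp_Pair:
  fixes f :: "'a::encodable \<Rightarrow> 'b::encodable"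
  assumes "fp f" "fp g"
  shows "fp (\<lambda>x. (f x, g x))"
proof -
  obtain c p where c: "\<And>s x. s 0 = encode x \<Longrightarrow>
      \<exists>t s'. exec c s t s' \<and> t \<le> poly p (esize x) \<and> s' 0 = encode (f x)"
    using assms(1) by (rule fpE) blast
  obtain d q where d: "\<And>s x. s 0 = encode x \<Longrightarrow>
      \<exists>t s'. exec d s t s' \<and> t \<le> poly q (esize x) \<and> s' 0 = encode (g x)"
    using assms(2) by (rule fpE) blast
  define m where "m = Suc (max (var_bound c) (var_bound d))"
  have m: "m > 0" "var_bound c \<le> m" "var_bound d \<le> m" "var_bound d \<le> Suc m"
    unfolding m_def by auto
  let ?P = "Seq (Assign m (Var 0)) (Seq c (Seq (Assign (Suc m) (Var 0))
    (Seq (Assign 0 (Var m)) (Seq d (Assign 0 (NodeE (Var (Suc m)) (Var 0)))))))"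
  let ?b = "\<lambda>x. 30 + 5 * esize x + 5 * esize (f x) + 5 * esize (g x) + poly p (esize x) + poly q (esize x)"
  show ?thesis
  proof (rule fpI[of ?P ?b])
    fix s :: state and x :: 'a
    assume s: "s 0 = encode x"
    define s1 where "s1 = s(m := encode x)"
    have e1: "exec (Assign m (Var 0)) s (1 + (1 + esize x)) s1"
      using exec.Assign[of m "Var 0" s] s by (simp add: s1_def)
    have "s1 0 = encode x" using s m by (simp add: s1_def)
    then obtain t2 s2 where e2: "exec c s1 t2 s2" "t2 \<le> poly p (esize x)" "s2 0 = encode (f x)"
      using c by blast
    have s2m: "s2 m = encode x"
      using exec_frame[OF e2(1) m(2)] by (simp add: s1_def)
    define s3 where "s3 = s2(Suc m := encode (f x))"
    have e3: "exec (Assign (Suc m) (Var 0)) s2 (1 + (1 + esize (f x))) s3"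
      using exec.Assign[of "Suc m" "Var 0" s2] e2 by (simp add: s3_def)
    define s4 where "s4 = s3(0 := encode x)"
    have e4: "exec (Assign 0 (Var m)) s3 (1 + (1 + esize x)) s4"
      using exec.Assign[of 0 "Var m" s3] s2m by (simp add: s4_def s3_def)
    have "s4 0 = encode x" by (simp add: s4_def)
    then obtain t5 s5 where e5: "exec d s4 t5 s5" "t5 \<le> poly q (esize x)" "s5 0 = encode (g x)"
      using d by blast
    have s5m: "s5 (Suc m) = encode (f x)"
      using exec_frame[OF e5(1) m(4)] by (simp add: s4_def s3_def)
    define s6 where "s6 = s5(0 := encode (f x, g x))"
    have e6: "exec (Assign 0 (NodeE (Var (Suc m)) (Var 0))) s5
        (5 + 2 * esize (f x) + 2 * esize (g x)) s6"
      unfolding s6_def by (rule exec_AssignI) (simp_all add: s5m e5)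
    show "\<exists>t s'. exec ?P s t s' \<and> t \<le> ?b x \<and> s' 0 = encode (f x, g x)"
      using exec.Seq[OF e1 exec.Seq[OF e2(1) exec.Seq[OF e3 exec.Seq[OF e4 exec.Seq[OF e5(1) e6]]]]]
        e2(2) e5(2)
      by - (intro exI conjI, assumption, auto simp: s6_def)
  qed (intro poly_bounded_intros fp_esize assms)
qed

lemma fp_comp2:
  assumes "fp (\<lambda>p. g (fst p) (snd p))" "fp f1" "fp f2"
  shows "fp (\<lambda>x. g (f1 x) (f2 x))"
  using fp_comp[OF assms(1) fp_Pair[OF assms(2,3)]] by simp

lemma fp_let:
  assumes "fp f" "fp (\<lambda>p. g (fst p) (snd p))"
  shows "fp (\<lambda>x. let y = f x in g x y)"
  using fp_comp[OF assms(2) fp_Pair[OF fp_id assms(1)]] by simp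

lemma fp_Cons:
  assumes "fp f" "fp g"
  shows "fp (\<lambda>x. f x # g x)"
proof -
  have "fp (\<lambda>p. fst p # snd p)"
    by (rule fp_recode) (auto simp: split_paired_all)
  from fp_comp[OF this fp_Pair[OF assms]] show ?thesis by simp
qed

lemma fp_branch:
  assumes "fp f" "fp g"
  shows "fp (\<lambda>p. if fst p then f (snd p) else g (snd p))"
proof -
  obtain c p where c: "\<And>s x. s 0 = encode x \<Longrightarrow>
      \<exists>t s'. exec c s t s' \<and> t \<le> poly p (esize x) \<and> s' 0 = encode (f x)"
    using assms(1) by (rule fpE) blast
  obtain d q where d: "\<And>s x. s 0 = encode x \<Longrightarrow>
      \<exists>t s'. exec d s t s' \<and> t \<le> poly q (esize x) \<and> s' 0 = encode (g x)"
    using assms(2) by (rule fpE) blast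
  let ?A = "Assign 0 (RightE (Var 0))"
  let ?P = "If (LeftE (Var 0)) (Seq ?A c) (Seq ?A d)"
  let ?b = "\<lambda>x. 20 + 5 * esize x + poly p (esize x) + poly q (esize x)"
  show ?thesis
  proof (rule fpI[of ?P ?b])
    fix s :: state and x :: "bool \<times> 'a"
    assume s: "s 0 = encode x"
    obtain b y where x: "x = (b, y)" by force
    define s1 where "s1 = s(0 := encode y)"
    have e1: "exec ?A s (3 + esize x + esize y) s1"
      unfolding s1_def by (rule exec_AssignI) (simp_all add: s x)
    have s1: "s1 0 = encode y" by (simp add: s1_def)
    have "esize y \<le> esize x" by (simp add: x)
    then have *: "poly p (esize y) \<le> poly p (esize x)" "poly q (esize y) \<le> poly q (esize x)" "esize y \<le> esize x"
      by (auto intro: poly_mono_nat)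
    show "\<exists>t s'. exec ?P s t s' \<and> t \<le> ?b x \<and>
        s' 0 = encode (if fst x then f (snd x) else g (snd x))"
    proof (cases b)
      case True
      obtain t2 s2 where e2: "exec c s1 t2 s2" "t2 \<le> poly p (esize y)" "s2 0 = encode (f y)"
        using c[of s1 y] s1 by blast
      have "val (LeftE (Var 0)) s \<noteq> Leaf" using s x True by simp
      from exec.IfTrue[OF this exec.Seq[OF e1 e2(1)]] show ?thesis
        using e2 * True s x by - (intro exI conjI, assumption, auto simp: x)
    next
      case False
      obtain t2 s2 where e2: "exec d s1 t2 s2" "t2 \<le> poly q (esize y)" "s2 0 = encode (g y)"
        using d[of s1 y] s1 by blast
      have "val (LeftE (Var 0)) s = Leaf" using s x False by simp
      from exec.IfFalse[OF this exec.Seq[OF e1 e2(1)]] show ?thesis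
        using e2 * False s x by - (intro exI conjI, assumption, auto simp: x)
    qed
  qed (intro poly_bounded_intros)
qed

lemma fp_if:
  assumes "fp b" "fp f" "fp g"
  shows "fp (\<lambda>x. if b x then f x else g x)"
  using fp_comp[OF fp_branch[OF assms(2,3)] fp_Pair[OF assms(1) fp_id]] by (simp cong: if_cong)

lemma if_bool_literals:
  "(if a then False else True) \<longleftrightarrow> \<not> a" "(if a then b else False) \<longleftrightarrow> a \<and> b"
  by auto

lemma fp_not: "fp b \<Longrightarrow> fp (\<lambda>x. \<not> b x)"
  using fp_if[OF _ fp_const[of False] fp_const[of True], of b] by (simp only: if_bool_literals)

lemma fp_conj: "fp a \<Longrightarrow> fp b \<Longrightarrow> fp (\<lambda>x. a x \<and> b x)"
  using fp_if[OF _ _ fp_const[of False], of a b] by (simp only: if_bool_literals)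

lemma fp_null:
  fixes f :: "'a::encodable \<Rightarrow> 'b::encodable list"
  assumes "fp f"
  shows "fp (\<lambda>x. f x = [])"
proof (rule fp_comp[OF _ assms])
  show "fp (\<lambda>xs :: 'b list. xs = [])"
  proof (rule fpI[of "If (Var 0) (Assign 0 LeafE) (Assign 0 (quote (encode True)))"
        "\<lambda>x. 20 + esize x"])
    fix s :: state and x :: "'b list"
    assume s: "s 0 = encode x"
    show "\<exists>t s'. exec (If (Var 0) (Assign 0 LeafE) (Assign 0 (quote (encode True)))) s t s' \<and>
        t \<le> 20 + esize x \<and> s' 0 = encode (x = [])"
    proof (cases "x = []")
      case True
      with s have "val (Var 0) s = Leaf" by simp
      with s True show ?thesis
        by - (intro exI conjI, rule exec.IfFalse[OF _ exec.Assign], auto)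
    next
      case False
      with s have "val (Var 0) s \<noteq> Leaf" by simp
      with s False show ?thesis
        by - (intro exI conjI, rule exec.IfTrue[OF _ exec.Assign], auto)
    qed
  qed (intro poly_bounded_intros)
qed

text \<open>No program is known to compute the junk value \<open>hd [] = undefined\<close>.\<close>

definition head_or :: "'a \<Rightarrow> 'a list \<Rightarrow> 'a" where
  "head_or d xs = (case xs of [] \<Rightarrow> d | x # _ \<Rightarrow> x)"

text \<open>One assignment covers both cases, because \<open>right Leaf = Leaf\<close> mirrors
  \<open>tl [] = []\<close>.\<close>

lemma fp_tl:
  fixes f :: "'a::encodable \<Rightarrow> 'b::encodable list"
  assumes "fp f"
  shows "fp (\<lambda>x. tl (f x))"
proof (rule fp_comp[OF _ assms])
  show "fp (tl :: 'b list \<Rightarrow> 'b list)"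
  proof (rule fpI[of "Assign 0 (RightE (Var 0))" "\<lambda>x. 3 + esize x + esize x"])
    fix s :: state and x :: "'b list"
    assume "s 0 = encode x"
    then show "\<exists>t s'. exec (Assign 0 (RightE (Var 0))) s t s' \<and> t \<le> 3 + esize x + esize x \<and>
        s' 0 = encode (tl x)"
      using exec.Assign[of 0 "RightE (Var 0)" s] by (cases x) fastforce+
  qed (intro poly_bounded_intros)
qed

lemma fp_head_or:
  fixes d :: "'a::encodable \<Rightarrow> 'b::encodable"
  assumes "fp d" "fp f"
  shows "fp (\<lambda>x. head_or (d x) (f x))"
proof -
  let ?P = "If (RightE (Var 0)) (Assign 0 (LeftE (RightE (Var 0)))) (Assign 0 (LeftE (Var 0)))"
  have "fp (\<lambda>p :: 'b \<times> 'b list. head_or (fst p) (snd p))"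
  proof (rule fpI[of ?P "\<lambda>x. 20 + 10 * esize x"])
    fix s :: state and x :: "'b \<times> 'b list"
    assume s: "s 0 = encode x"
    obtain y ys where x: "x = (y, ys)" by force
    show "\<exists>t s'. exec ?P s t s' \<and> t \<le> 20 + 10 * esize x \<and> s' 0 = encode (head_or (fst x) (snd x))"
    proof (cases ys)
      case Nil
      with s x have "val (RightE (Var 0)) s = Leaf" by simp
      with s Nil x show ?thesis
        by - (intro exI conjI, rule exec.IfFalse[OF _ exec.Assign], auto simp: head_or_def)
    next
      case Cons
      with s x have "val (RightE (Var 0)) s \<noteq> Leaf" by simp
      with s Cons x show ?thesis
        by - (intro exI conjI, rule exec.IfTrue[OF _ exec.Assign], auto simp: head_or_def)
    qed
  qed (intro poly_bounded_intros)
  from fp_comp[OF this fp_Pair[OF assms]] show ?thesis by simp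
qed

section \<open>Loops\<close>

lemma foldl_esize_le:
  assumes "\<And>a y. y \<in> set ys \<Longrightarrow> esize (h a y) \<le> esize a + K"
  shows "esize (foldl h a ys) \<le> esize a + length ys * K"
  using assms
proof (induction ys arbitrary: a)
  case (Cons y ys)
  have "esize (foldl h a (y # ys)) \<le> esize (h a y) + length ys * K"
    using Cons by simp
  with Cons.prems[of y a] show ?case by simp
qed simp

text \<open>The loop keeps the environment in variable \<open>d\<close>, the rest of the list in \<open>d + 1\<close> and the
  accumulator in \<open>d + 2\<close>. The bound on the growth of the accumulator must not depend on the
  accumulator itself.\<close>

lemma fp_foldl_step:
  fixes h :: "'e::encodable \<Rightarrow> 'a::encodable \<Rightarrow> 'b::encodable \<Rightarrow> 'a"
  assumes "fp (\<lambda>p. h (fst p) (fst (snd p)) (snd (snd p)))"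
    and growth: "\<And>e a y. esize (h e a y) \<le> esize a + poly q (esize (e, y))"
  shows "fp (\<lambda>p. foldl (h (fst p)) (fst (snd p)) (snd (snd p)))"
proof -
  obtain c p where c: "\<And>s x. s 0 = encode x \<Longrightarrow>
      \<exists>t s'. exec c s t s' \<and> t \<le> poly p (esize x) \<and>
        s' 0 = encode (h (fst x) (fst (snd x)) (snd (snd x)))"
    using assms(1) by (rule fpE) blast
  define d where "d = Suc (var_bound c)"
  have d: "var_bound c \<le> d" "var_bound c \<le> d + 1" "var_bound c \<le> d + 2" "d > 0"
    unfolding d_def by auto
  let ?set = "Assign 0 (NodeE (Var d) (NodeE (Var (d + 2)) (LeftE (Var (d + 1)))))"
  let ?body = "Seq ?set (Seq c (Seq (Assign (d + 2) (Var 0)) (Assign (d + 1) (RightE (Var (d + 1))))))"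
  let ?loop = "While (Var (d + 1)) ?body"
  let ?pre = "Seq (Assign d (LeftE (Var 0))) (Seq (Assign (d + 1) (RightE (RightE (Var 0))))
    (Assign (d + 2) (LeftE (RightE (Var 0)))))"
  let ?P = "Seq ?pre (Seq ?loop (Assign 0 (Var (d + 2))))"
  \<comment> \<open>\<open>M\<close> bounds the environment, the list and every intermediate
    accumulator; stating the last through \<open>take n\<close> lets the hypothesis pass to the rest
    of the list.\<close>
  have loop: "\<exists>t s'. exec ?loop s t s' \<and> t \<le> length ys * (100 + 40 * M + poly p (4 * M + 2)) + 2 + M \<and>
      s' (d + 2) = encode (foldl (h e) a ys)"
    if "s d = encode e" "s (d + 1) = encode ys" "s (d + 2) = encode a"
      "esize e \<le> M" "esize ys \<le> M" "\<And>n. esize (foldl (h e) a (take n ys)) \<le> M" for s e ys a M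
    using that
  proof (induction ys arbitrary: s a)
    case Nil
    then have "exec ?loop s (1 + exp_time (Var (d + 1)) s) s"
      by (intro exec.WhileFalse) simp
    with Nil show ?case by auto
  next
    case (Cons y ys)
    have a: "esize a \<le> M" using Cons.prems(6)[of 0] by simp
    have a': "esize (h e a y) \<le> M" using Cons.prems(6)[of 1] by simp
    have y: "Suc (esize y + esize ys) \<le> M" using Cons.prems by simp
    define s1 where "s1 = s(0 := encode (e, a, y))"
    have e1: "exec ?set s (11 + 2 * esize e + 3 * esize a + 4 * esize y + esize ys) s1"
      unfolding s1_def by (rule exec_AssignI) (use Cons.prems in \<open>simp_all\<close>)
    obtain t2 s2 where e2: "exec c s1 t2 s2" "t2 \<le> poly p (esize (e, a, y))" "s2 0 = encode (h e a y)"
      using c[of s1 "(e, a, y)"] by (auto simp: s1_def)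
    have "esize (e, a, y) \<le> 4 * M + 2" using a y Cons.prems(4) by simp
    then have t2: "t2 \<le> poly p (4 * M + 2)" using e2(2) poly_mono_nat le_trans by blast
    have s2: "s2 d = encode e" "s2 (d + 1) = encode (y # ys)"
      using exec_frame[OF e2(1) d(1)] exec_frame[OF e2(1) d(2)] d(4) Cons.prems
      by (auto simp: s1_def)
    define s3 where "s3 = s2(d + 2 := encode (h e a y))"
    have e3: "exec (Assign (d + 2) (Var 0)) s2 (2 + esize (h e a y)) s3"
      unfolding s3_def by (rule exec_AssignI) (simp_all add: e2)
    define s4 where "s4 = s3(d + 1 := encode ys)"
    have e4: "exec (Assign (d + 1) (RightE (Var (d + 1)))) s3 (4 + esize y + 2 * esize ys) s4"
      unfolding s4_def by (rule exec_AssignI) (use s2 in \<open>simp_all add: s3_def\<close>)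
    have s4: "s4 d = encode e" "s4 (d + 1) = encode ys" "s4 (d + 2) = encode (h e a y)"
      using s2 by (auto simp: s4_def s3_def)
    have "esize (foldl (h e) (h e a y) (take n ys)) \<le> M" for n
      using Cons.prems(6)[of "Suc n"] by simp
    with Cons.IH[OF s4 Cons.prems(4)] y obtain t5 s5 where
      e5: "exec ?loop s4 t5 s5" "t5 \<le> length ys * (100 + 40 * M + poly p (4 * M + 2)) + 2 + M"
        "s5 (d + 2) = encode (foldl (h e) (h e a y) ys)"
      by auto
    have "val (Var (d + 1)) s \<noteq> Leaf" using Cons.prems by simp
    from exec.WhileTrue[OF this exec.Seq[OF e1 exec.Seq[OF e2(1) exec.Seq[OF e3 e4]]] e5(1)]
    show ?case
      using e5(2,3) t2 a a' y Cons.prems(2,4)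
      by - (intro exI conjI, assumption, auto)
  qed
  \<comment> \<open>There are at most \<open>esize x\<close> rounds, and each adds at most
    \<open>poly q (esize x)\<close>, since the environment with one list entry is no larger than the
    whole input.\<close>
  define B where "B = (\<lambda>x :: 'e \<times> 'a \<times> 'b list.
    esize x + esize x * poly q (esize x))"
  have B: "esize (foldl (h e) a (take n ys)) \<le> B (e, a, ys)" for e a ys n
  proof -
    let ?x = "(e, a, ys)"
    have "esize (foldl (h e) a (take n ys)) \<le> esize a + length (take n ys) * poly q (esize ?x)"
    proof (rule foldl_esize_le)
      fix a y
      assume "y \<in> set (take n ys)"
      then have "esize y < esize ys"
        using esize_le_list in_set_takeD by fastforce
      then have "poly q (esize (e, y)) \<le> poly q (esize ?x)"
        by (intro poly_mono_nat) simp
      then show "esize (h e a y) \<le> esize a + poly q (esize ?x)"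
        using growth[of e a y] by simp
    qed
    also have "\<dots> \<le> esize ?x + esize ?x * poly q (esize ?x)"
      using esize_take[of n ys] length_le_esize[of "take n ys"]
      by (intro add_mono mult_mono) auto
    finally show ?thesis by (simp add: B_def)
  qed
  have B_ge: "esize x \<le> B x" for x
    by (simp add: B_def)
  let ?b = "\<lambda>x. 50 + 20 * esize x + (esize x * (100 + 40 * B x + poly p (4 * B x + 2)) + 2 + B x) + B x"
  show ?thesis
  proof (rule fpI[of ?P ?b])
    fix s :: state and x :: "'e \<times> 'a \<times> 'b list"
    assume s: "s 0 = encode x"
    obtain e a ys where x: "x = (e, a, ys)" by (metis surj_pair)
    define s1 where "s1 = s(d := encode e, d + 1 := encode ys, d + 2 := encode a)"
    have e1: "exec ?pre s (21 + 4 * esize e + 6 * esize a + 6 * esize ys) s1"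
    proof -
      have "exec (Assign d (LeftE (Var 0))) s (5 + 2 * esize e + esize a + esize ys) (s(d := encode e))"
        by (rule exec_AssignI) (simp_all add: s x)
      moreover have "exec (Assign (d + 1) (RightE (RightE (Var 0)))) (s(d := encode e))
          (7 + esize e + 2 * esize a + 3 * esize ys) (s(d := encode e, d + 1 := encode ys))"
        by (rule exec_AssignI) (use d in \<open>simp_all add: s x\<close>)
      moreover have "exec (Assign (d + 2) (LeftE (RightE (Var 0)))) (s(d := encode e, d + 1 := encode ys))
          (7 + esize e + 3 * esize a + 2 * esize ys) s1"
        unfolding s1_def by (rule exec_AssignI) (use d in \<open>simp_all add: s x\<close>)
      ultimately have "exec ?pre s (1 + (5 + 2 * esize e + esize a + esize ys) + (1 + (7 + esize e + 2 * esize a + 3 * esize ys) + (7 + esize e + 3 * esize a + 2 * esize ys))) s1"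
        by (intro exec.Seq)
      moreover have "1 + (5 + 2 * esize e + esize a + esize ys) + (1 + (7 + esize e + 2 * esize a + 3 * esize ys) + (7 + esize e + 3 * esize a + 2 * esize ys)) = 21 + 4 * esize e + 6 * esize a + 6 * esize ys"
        by simp
      ultimately show ?thesis by (simp only:)
    qed
    have "esize e \<le> B x" "esize ys \<le> B x"
      using B_ge[of x] by (simp_all add: x)
    then obtain t2 s2 where e2: "exec ?loop s1 t2 s2"
      "t2 \<le> length ys * (100 + 40 * B x + poly p (4 * B x + 2)) + 2 + B x"
      "s2 (d + 2) = encode (foldl (h e) a ys)"
      using loop[of s1 e ys a "B x"] B[of e a _ ys] by (auto simp: s1_def x)
    have "length ys \<le> esize x" using length_le_esize[of ys] by (simp add: x)
    then have t2: "t2 \<le> esize x * (100 + 40 * B x + poly p (4 * B x + 2)) + 2 + B x"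
      using e2(2) by (meson add_le_mono1 le_trans mult_le_mono1)
    have r: "esize (foldl (h e) a ys) \<le> B x"
      using B[of e a "length ys" ys] by (simp add: x)
    have e3: "exec (Assign 0 (Var (d + 2))) s2 (2 + esize (foldl (h e) a ys)) (s2(0 := encode (foldl (h e) a ys)))"
      by (rule exec_AssignI) (use e2(3) in simp_all)
    show "\<exists>t s'. exec ?P s t s' \<and> t \<le> ?b x \<and>
        s' 0 = encode (foldl (h (fst x)) (fst (snd x)) (snd (snd x)))"
      using exec.Seq[OF e1 exec.Seq[OF e2(1) e3]] t2 r
      by - (intro exI conjI, assumption, auto simp: x)
  qed (unfold B_def, intro poly_bounded_intros)
qed

text \<open>The form used for algorithms: the environment is the entire outer argument
  \<open>x\<close>, so the body of the loop may refer to everything in scope, and the growth bound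
  may be any polynomially bounded function of \<open>x\<close> and the current entry.\<close>

lemma fp_foldl:
  fixes h :: "'e::encodable \<Rightarrow> 'a::encodable \<Rightarrow> 'b::encodable \<Rightarrow> 'a"
  assumes h: "fp (\<lambda>p. h (fst p) (fst (snd p)) (snd (snd p)))" and a: "fp a" and l: "fp l"
    and b: "poly_bounded b" and growth: "\<And>x a y. esize (h x a y) \<le> esize a + b (x, y)"
  shows "fp (\<lambda>x. foldl (h x) (a x) (l x))"
proof -
  obtain q where q: "\<And>p. b p \<le> poly q (esize p)"
    using b unfolding poly_bounded_def by blast
  have "fp (\<lambda>p. foldl (h (fst p)) (fst (snd p)) (snd (snd p)))"
  proof (rule fp_foldl_step[OF h])
    show "esize (h e a y) \<le> esize a + poly q (esize (e, y))" for e a y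
      using growth[of e a y] q[of "(e, y)"] by linarith
  qed
  from fp_comp[OF this fp_Pair[OF fp_id fp_Pair[OF a l]]] show ?thesis by simp
qed

lemma fp_foldl_const:
  fixes h :: "'e::encodable \<Rightarrow> 'a::encodable \<Rightarrow> 'b::encodable \<Rightarrow> 'a"
  assumes "fp (\<lambda>p. h (fst p) (fst (snd p)) (snd (snd p)))" "fp a" "fp l"
    and "\<And>x a y. esize (h x a y) \<le> esize a + k"
  shows "fp (\<lambda>x. foldl (h x) (a x) (l x))"
  by (rule fp_foldl[OF assms(1-3) poly_bounded_const assms(4)])

lemma fp_foldl_elem:
  fixes h :: "'e::encodable \<Rightarrow> 'a::encodable \<Rightarrow> 'b::encodable \<Rightarrow> 'a"
  assumes "fp (\<lambda>p. h (fst p) (fst (snd p)) (snd (snd p)))" "fp a" "fp l" "fp g"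
    and "\<And>x a y. esize (h x a y) \<le> esize a + esize (g (x, y)) + k"
  shows "fp (\<lambda>x. foldl (h x) (a x) (l x))"
proof (rule fp_foldl[where b = "\<lambda>p. esize (g p) + k"])
  show "poly_bounded (\<lambda>p. esize (g p) + k)"
    by (intro poly_bounded_intros fp_esize assms)
  show "esize (h x a y) \<le> esize a + (esize (g (x, y)) + k)" for x a y
    using assms(5)[of x a y] by simp
qed (fact assms)+

section \<open>Lists\<close>

lemmas fp_basic = fp_id fp_fst fp_snd fp_const fp_Pair fp_Cons fp_let fp_if fp_not fp_conj
  fp_null fp_tl fp_head_or

lemma foldl_Cons_map: "foldl (\<lambda>acc y. h y # acc) acc xs = rev (map h xs) @ acc"
  by (induction xs arbitrary: acc) auto

lemma foldl_Cons: "foldl (\<lambda>acc y. y # acc) acc xs = rev xs @ acc"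
  by (induction xs arbitrary: acc) auto

lemma foldl_append: "foldl (\<lambda>acc y. acc @ y) acc xs = acc @ concat xs"
  by (induction xs arbitrary: acc) auto

lemma fp_rev: "fp l \<Longrightarrow> fp (\<lambda>x. rev (l x))"
proof -
  assume "fp l"
  then have "fp (\<lambda>x. foldl (\<lambda>acc y. y # acc) [] (l x))"
    by (intro fp_foldl_elem[where g = snd and k = 1] fp_basic) auto
  then show ?thesis by (simp add: foldl_Cons)
qed

lemma fp_append: "fp f \<Longrightarrow> fp g \<Longrightarrow> fp (\<lambda>x. f x @ g x)"
proof -
  assume "fp f" "fp g"
  then have "fp (\<lambda>x. foldl (\<lambda>acc y. y # acc) (g x) (rev (f x)))"
    by (intro fp_foldl_elem[where g = snd and k = 1] fp_basic fp_rev) auto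
  then show ?thesis by (simp add: foldl_Cons)
qed

lemma fp_map:
  assumes "fp (\<lambda>p. h (fst p) (snd p))" "fp l"
  shows "fp (\<lambda>x. map (h x) (l x))"
proof -
  have "fp (\<lambda>x. foldl (\<lambda>acc y. h x y # acc) [] (l x))"
  proof (rule fp_foldl_elem[where g = "\<lambda>p. h (fst p) (snd p)" and k = 1])
    show "fp (\<lambda>p. h (fst p) (snd (snd p)) # fst (snd p))"
      by (intro fp_basic fp_comp2[OF assms(1)])
  qed (auto intro: assms fp_basic)
  then have "fp (\<lambda>x. rev (foldl (\<lambda>acc y. h x y # acc) [] (l x)))"
    by (rule fp_rev)
  then show ?thesis by (simp add: foldl_Cons_map)
qed

lemma foldl_filter: "foldl (\<lambda>acc y. if P y then y # acc else acc) acc xs = rev (filter P xs) @ acc"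
  by (induction xs arbitrary: acc) auto

lemma fp_filter:
  assumes "fp (\<lambda>p. P (fst p) (snd p))" "fp l"
  shows "fp (\<lambda>x. filter (P x) (l x))"
proof -
  have "fp (\<lambda>x. foldl (\<lambda>acc y. if P x y then y # acc else acc) [] (l x))"
  proof (rule fp_foldl_elem[where g = snd and k = 1])
    show "fp (\<lambda>p. if P (fst p) (snd (snd p)) then snd (snd p) # fst (snd p) else fst (snd p))"
      by (intro fp_basic fp_comp2[OF assms(1)])
  qed (auto intro: assms fp_basic)
  then have "fp (\<lambda>x. rev (foldl (\<lambda>acc y. if P x y then y # acc else acc) [] (l x)))"
    by (rule fp_rev)
  then show ?thesis by (simp add: foldl_filter)
qed

lemma fp_concat: "fp l \<Longrightarrow> fp (\<lambda>x. concat (l x))"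
proof -
  assume "fp l"
  then have "fp (\<lambda>x. foldl (\<lambda>acc y. acc @ y) [] (l x))"
    by (intro fp_foldl_elem[where g = snd and k = 0] fp_basic fp_append) (auto simp: esize_append)
  then show ?thesis by (simp add: foldl_append)
qed

lemma fp_list_ex:
  assumes "fp (\<lambda>p. P (fst p) (snd p))" "fp l"
  shows "fp (\<lambda>x. \<exists>y \<in> set (l x). P x y)"
proof -
  have "fp (\<lambda>x. filter (P x) (l x) \<noteq> [])"
    by (intro fp_filter fp_not fp_null assms)
  moreover have "filter (P x) (l x) \<noteq> [] \<longleftrightarrow> (\<exists>y \<in> set (l x). P x y)" for x
    by (auto simp: filter_empty_conv)
  ultimately show ?thesis by simp
qed

section \<open>Equality of numbers in binary\<close>

text \<open>The list whose encoding is the same tree as that of \<open>n\<close>, so that loops over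
  lists can run over binary digits.\<close>

fun bits :: "nat \<Rightarrow> bool list" where
  "bits n = (if n = 0 then [] else odd n # bits (n div 2))"

declare bits.simps [simp del]

lemma encode_bits: "encode (bits n) = encode n"
proof (induction n rule: bits.induct)
  case (1 n)
  then show ?case
    by (cases "n = 0") (auto simp: bits.simps[of n] enc_nat.simps[of n] enc_nat.simps[of 0] bits.simps[of 0] encode_nat_def encode_bool_def)
qed

lemma bits_inject: "bits m = bits n \<longleftrightarrow> m = n"
  using encode_bits[of m] encode_bits[of n] enc_nat_inj by (auto simp: encode_nat_def)

lemma fp_bits: "fp f \<Longrightarrow> fp (\<lambda>x. bits (f x))"
  by (rule fp_comp[of bits]) (rule fp_recode, simp add: encode_bits)

text \<open>Two lists are traversed by a single fold: it runs over one of them and consumes the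
  other inside the accumulator, next to a flag that records agreement so far.\<close>

definition cmp :: "bool \<times> bool list \<Rightarrow> bool \<Rightarrow> bool \<times> bool list" where
  "cmp a b = (fst a \<and> snd a \<noteq> [] \<and> (if b then head_or False (snd a) else \<not> head_or False (snd a)),
    tl (snd a))"

lemma foldl_cmp: "foldl cmp (ok, ys) xs = (ok', zs) \<Longrightarrow> ok' \<and> zs = [] \<longleftrightarrow> ok \<and> ys = xs"
proof (induction xs arbitrary: ok ys)
  case (Cons x xs)
  from Cons.prems Cons.IH[of "fst (cmp (ok, ys) x)" "snd (cmp (ok, ys) x)"] show ?case
    by (cases ys) (auto simp: cmp_def head_or_def split: if_splits)
qed simp

lemma fp_eq_bools:
  fixes f g :: "'a::encodable \<Rightarrow> bool list"
  assumes "fp f" "fp g"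
  shows "fp (\<lambda>x. f x = g x)"
proof -
  have "fp (\<lambda>x. foldl cmp (True, f x) (g x))"
  proof (rule fp_foldl_const[where k = 2])
    show "fp (\<lambda>p. cmp (fst (snd p)) (snd (snd p)))"
      unfolding cmp_def by (intro fp_basic)
    show "esize (cmp a y) \<le> esize a + 2" for a y
      using esize_drop[of 1 "snd a"]
      by (cases a) (auto simp: cmp_def drop_Suc encode_bool_def)
  qed (intro fp_basic assms)+
  then have "fp (\<lambda>x. fst (foldl cmp (True, f x) (g x)) \<and> snd (foldl cmp (True, f x) (g x)) = [])"
    by (intro fp_basic)
  moreover have "fst (foldl cmp (True, f x) (g x)) \<and> snd (foldl cmp (True, f x) (g x)) = [] \<longleftrightarrow> f x = g x" for x
    using foldl_cmp[of True "f x" "g x"] by (metis prod.collapse)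
  ultimately show ?thesis by simp
qed

lemma fp_eq_nat:
  fixes f g :: "'a::encodable \<Rightarrow> nat"
  shows "fp f \<Longrightarrow> fp g \<Longrightarrow> fp (\<lambda>x. f x = g x)"
  using fp_eq_bools[OF fp_bits fp_bits] by (simp add: bits_inject)

lemma fp_member:
  fixes f :: "'a::encodable \<Rightarrow> nat"
  assumes "fp f" "fp l"
  shows "fp (\<lambda>x. f x \<in> set (l x))"
proof -
  have "fp (\<lambda>x. \<exists>y \<in> set (l x). y = f x)"
    by (intro fp_list_ex fp_eq_nat fp_basic assms fp_comp[OF assms(1)])
  then show ?thesis by simp
qed

section \<open>Arithmetic in unary\<close>

definition units :: "int \<Rightarrow> unit list" where
  "units i = replicate (nat i) ()"

lemma length_units [simp]: "length (units i) = nat i"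
  by (simp add: units_def)

lemma fp_units: "fp f \<Longrightarrow> fp (\<lambda>x. units (f x))"
proof (rule fp_comp[of units])
  have "fp (\<lambda>i. (units i, units (- i)))"
    by (rule fp_recode) (simp add: encode_int_def units_def)
  from fp_fst[OF this] show "fp units" by simp
qed

lemma fp_units_minus: "fp f \<Longrightarrow> fp (\<lambda>x. units (- f x))"
proof (rule fp_comp[of "\<lambda>i. units (- i)"])
  have "fp (\<lambda>i. (units i, units (- i)))"
    by (rule fp_recode) (simp add: encode_int_def units_def)
  from fp_snd[OF this] show "fp (\<lambda>i. units (- i))" by simp
qed

text \<open>Adds one unit to a number given by its positive and negative part, cancelling against
  the negative part while that lasts. Starting from an empty positive part, one of the two
  components is always empty, as in the encoding of integers.\<close>

definition cancel :: "unit list \<times> unit list \<Rightarrow> unit list \<times> unit list" where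
  "cancel a = (if snd a = [] then (() # fst a, []) else (fst a, tl (snd a)))"

lemma foldl_cancel:
  "foldl (\<lambda>a _. cancel a) (replicate p (), replicate m ()) ys =
    (replicate (p + (length ys - m)) (), replicate (m - length ys) ())"
proof (induction ys arbitrary: p m)
  case (Cons y ys)
  show ?case
  proof (cases m)
    case 0
    then have "cancel (replicate p (), replicate m ()) = (replicate (Suc p) (), replicate 0 ())"
      by (simp add: cancel_def)
    then show ?thesis using Cons.IH[of "Suc p" 0] 0 by (simp del: replicate.simps)
  next
    case (Suc m')
    then have "cancel (replicate p (), replicate m ()) = (replicate p (), replicate m' ())"
      by (simp add: cancel_def)
    then show ?thesis using Cons.IH[of p m'] Suc by (simp del: replicate.simps)
  qed
qed simp

text \<open>The basis of unary arithmetic: sums and differences of integers become differences of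
  lengths once positive and negative parts are concatenated.\<close>

lemma fp_diff_length:
  fixes f g :: "'a::encodable \<Rightarrow> unit list"
  assumes "fp f" "fp g"
  shows "fp (\<lambda>x. int (length (f x)) - int (length (g x)))"
proof -
  have "fp (\<lambda>x. foldl (\<lambda>a _. cancel a) ([], g x) (f x))"
  proof (rule fp_foldl_const[where k = 1])
    show "fp (\<lambda>p. cancel (fst (snd p)))"
      unfolding cancel_def by (intro fp_basic)
    show "esize (cancel a) \<le> esize a + 1" for a
      using esize_drop[of 1 "snd a"]
      by (cases a) (auto simp: cancel_def drop_Suc)
  qed (intro fp_basic assms)+
  moreover have "encode (foldl (\<lambda>a _. cancel a) ([], g x) (f x)) =
      encode (int (length (f x)) - int (length (g x)))" for x
  proof -
    have "g x = replicate (length (g x)) ()" by (simp add: replicate_length_same)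
    then have "foldl (\<lambda>a _. cancel a) ([], g x) (f x) =
        (replicate (length (f x) - length (g x)) (), replicate (length (g x) - length (f x)) ())"
      using foldl_cancel[of 0 "length (g x)" "f x"] by simp
    then show ?thesis by (simp add: encode_int_def nat_diff_distrib' flip: of_nat_diff nat_minus_as_int)
  qed
  ultimately show ?thesis unfolding fp_def by simp
qed

lemma fp_length: "fp l \<Longrightarrow> fp (\<lambda>x. int (length (l x)))"
  using fp_diff_length[OF fp_map[OF fp_const[of "()"], of l] fp_const[of "[]"]] by simp

context
  fixes f g :: "'a::encodable \<Rightarrow> int"
  assumes fg: "fp f" "fp g"
begin

lemma fp_plus: "fp (\<lambda>x. f x + g x)"
proof -
  have "fp (\<lambda>x. int (length (units (f x) @ units (g x))) - int (length (units (- f x) @ units (- g x))))"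
    by (intro fp_diff_length fp_append fp_units fp_units_minus fg)
  moreover have "int (length (units (f x) @ units (g x))) - int (length (units (- f x) @ units (- g x))) =
      f x + g x" for x
    by simp
  ultimately show ?thesis by simp
qed

lemma fp_minus: "fp (\<lambda>x. f x - g x)"
proof -
  have "fp (\<lambda>x. int (length (units (f x) @ units (- g x))) - int (length (units (- f x) @ units (g x))))"
    by (intro fp_diff_length fp_append fp_units fp_units_minus fg)
  moreover have "int (length (units (f x) @ units (- g x))) - int (length (units (- f x) @ units (g x))) =
      f x - g x" for x
    by simp
  ultimately show ?thesis by simp
qed

end

lemma fp_uminus: "fp f \<Longrightarrow> fp (\<lambda>x. - f x :: int)"
  using fp_minus[OF fp_const[of 0]] by simp

lemma fp_le:
  fixes f g :: "'a::encodable \<Rightarrow> int"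
  assumes "fp f" "fp g"
  shows "fp (\<lambda>x. f x \<le> g x)"
proof -
  have "fp (\<lambda>x. units (f x - g x) = [])"
    by (intro fp_null fp_units fp_minus assms)
  moreover have "units i = [] \<longleftrightarrow> i \<le> 0" for i
    by (simp add: units_def)
  ultimately show ?thesis by simp
qed

lemma fp_less:
  fixes f g :: "'a::encodable \<Rightarrow> int"
  shows "fp f \<Longrightarrow> fp g \<Longrightarrow> fp (\<lambda>x. f x < g x)"
  using fp_not[OF fp_le[of g f]] by (simp add: not_le)

lemma fp_max:
  fixes f g :: "'a::encodable \<Rightarrow> int"
  shows "fp f \<Longrightarrow> fp g \<Longrightarrow> fp (\<lambda>x. max (f x) (g x))"
  unfolding max_def by (intro fp_if fp_le)

lemma fp_min:
  fixes f g :: "'a::encodable \<Rightarrow> int"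
  shows "fp f \<Longrightarrow> fp g \<Longrightarrow> fp (\<lambda>x. min (f x) (g x))"
  unfolding min_def by (intro fp_if fp_le)

lemma foldl_plus_const: "foldl (\<lambda>a _. a + j) i ys = i + int (length ys) * (j :: int)"
  by (induction ys arbitrary: i) (auto simp: algebra_simps)

text \<open>Repeated addition, with the positive and the negative part of \<open>f x\<close> as loop
  counters. The summand \<open>g x\<close> belongs to the environment, so it gives an admissible
  growth bound.\<close>

lemma fp_times:
  fixes f g :: "'a::encodable \<Rightarrow> int"
  assumes "fp f" "fp g"
  shows "fp (\<lambda>x. f x * g x)"
proof -
  have *: "fp (\<lambda>x. foldl (\<lambda>a _. a + g x) 0 (l x))" if "fp l" for l :: "'a \<Rightarrow> unit list"
  proof (rule fp_foldl_elem[where g = "\<lambda>p. g (fst p)" and k = 0])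
    show "fp (\<lambda>p. fst (snd p) + g (fst p))"
      by (intro fp_plus fp_basic fp_comp[OF assms(2)])
    show "fp (\<lambda>p. g (fst p))"
      by (intro fp_basic fp_comp[OF assms(2)])
  qed (auto intro: fp_basic that simp: esize_int)
  have "fp (\<lambda>x. foldl (\<lambda>a _. a + g x) 0 (units (f x)) - foldl (\<lambda>a _. a + g x) 0 (units (- f x)))"
    by (intro fp_minus * fp_units fp_units_minus assms)
  moreover have "foldl (\<lambda>a _. a + g x) 0 (units (f x)) - foldl (\<lambda>a _. a + g x) 0 (units (- f x)) = f x * g x" for x
    by (cases "f x \<ge> 0") (auto simp: foldl_plus_const)
  ultimately show ?thesis by simp
qed

lemma fp_sum_list:
  fixes l :: "'a::encodable \<Rightarrow> int list"
  assumes "fp l"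
  shows "fp (\<lambda>x. sum_list (l x))"
proof -
  have "fp (\<lambda>x. foldl (+) 0 (l x))"
    by (rule fp_foldl_elem[where g = snd and k = 0];
      (intro fp_plus fp_basic assms | simp add: esize_int))
  moreover have "foldl (+) a ys = a + sum_list ys" for a :: int and ys
    by (induction ys arbitrary: a) auto
  ultimately show ?thesis by simp
qed

text \<open>Horner's rule on the bits, most significant first. The cap is applied in every round
  because \<open>n\<close> in unary may be exponentially large; no information is lost, as a partial
  value of at least \<open>b \<ge> 0\<close> stays at least \<open>b\<close> under doubling.\<close>

definition capped :: "int \<Rightarrow> nat \<Rightarrow> int" where
  "capped b n = foldl (\<lambda>a d. max 0 (min b (a + a + (if d then 1 else 0)))) 0 (rev (bits n))"

lemma capped_eq: "b \<ge> 0 \<Longrightarrow> capped b n = min b (int n)"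
proof (induction n rule: bits.induct)
  case (1 n)
  show ?case
  proof (cases "n = 0")
    case False
    then have "capped b n = max 0 (min b (capped b (n div 2) + capped b (n div 2) + (if odd n then 1 else 0)))"
      by (simp add: capped_def bits.simps[of n])
    moreover have "int n = 2 * int (n div 2) + (if odd n then 1 else 0)"
      by presburger
    ultimately show ?thesis using 1 False by (auto simp: min_def max_def)
  qed (use 1 in \<open>auto simp: capped_def bits.simps\<close>)
qed

lemma fp_capped:
  assumes "fp b" "fp f"
  shows "fp (\<lambda>x. capped (b x) (f x))"
  unfolding capped_def
proof (rule fp_foldl_elem[where g = "\<lambda>p. b (fst p)" and k = 1])
  show "fp (\<lambda>p. max 0 (min (b (fst p)) (fst (snd p) + fst (snd p) + (if snd (snd p) then 1 else 0))))"
    by (intro fp_max fp_min fp_plus fp_basic fp_comp[OF assms(1)])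
  show "fp (\<lambda>p. b (fst p))"
    by (intro fp_basic fp_comp[OF assms(1)])
  show "fp (\<lambda>x. rev (bits (f x)))"
    by (intro fp_rev fp_bits assms)
qed (auto intro: fp_basic simp: esize_int)

definition enumerated :: "'a list \<Rightarrow> ('a \<times> int) list" where
  "enumerated xs = rev (foldl (\<lambda>acc x. (x, int (length acc)) # acc) [] xs)"

lemma foldl_enumerate:
  "foldl (\<lambda>acc x. (x, int (length acc)) # acc) acc xs =
    rev (zip xs (map int [length acc..<length acc + length xs])) @ acc"
  by (induction xs arbitrary: acc) (auto simp: upt_rec)

lemma enumerated_eq: "enumerated xs = zip xs (map int [0..<length xs])"
  by (simp add: enumerated_def foldl_enumerate)

text \<open>The index is bounded by the length of the whole list, which belongs to the environment.\<close>

lemma fp_enumerated: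
  assumes "fp l"
  shows "fp (\<lambda>x. enumerated (l x))"
proof -
  have "fp (\<lambda>x. foldl (\<lambda>acc y. (y, min (int (length (l x))) (int (length acc))) # acc) [] (l x))"
  proof (rule fp_foldl_elem[where g = "\<lambda>p. (snd p, int (length (l (fst p))))" and k = 1])
    show "fp (\<lambda>p. (snd (snd p), min (int (length (l (fst p)))) (int (length (fst (snd p))))) # fst (snd p))"
      by (intro fp_basic fp_min fp_length fp_comp[OF assms])
    show "fp (\<lambda>p. (snd p, int (length (l (fst p)))))"
      by (intro fp_basic fp_length fp_comp[OF assms])
  qed (auto simp: esize_int intro: fp_basic assms)
  moreover have "foldl (\<lambda>acc y. (y, min b (int (length acc))) # acc) acc ys =
      foldl (\<lambda>acc y. (y, int (length acc)) # acc) acc ys"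
    if "int (length acc + length ys) \<le> b" for b :: int and acc :: "('b \<times> int) list" and ys
    using that by (induction ys arbitrary: acc) (auto simp: min_def)
  ultimately have "fp (\<lambda>x. foldl (\<lambda>acc y. (y, int (length acc)) # acc) [] (l x))"
    by simp
  then show ?thesis unfolding enumerated_def by (rule fp_rev)
qed

section \<open>Submodular minimization\<close>

definition submodular_on :: "'a set \<Rightarrow> ('a set \<Rightarrow> int) \<Rightarrow> bool" where
  "submodular_on U f \<longleftrightarrow> (\<forall>A B. A \<subseteq> U \<longrightarrow> B \<subseteq> U \<longrightarrow> f (A \<union> B) + f (A \<inter> B) \<le> f A + f B)"

lemma exists_minimizer:
  fixes g :: "'a set \<Rightarrow> int"
  assumes "finite U"
  shows "\<exists>X\<subseteq>U. \<forall>A\<subseteq>U. g X \<le> g A"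
proof -
  have "\<exists>X. is_arg_min g (\<lambda>A. A \<in> Pow U) X"
    using assms by (intro ex_is_arg_min_if_finite) auto
  then show ?thesis by (auto simp: is_arg_min_linorder)
qed

section \<open>Greedy vectors and the Lovasz extension\<close>

context
  fixes U :: "'a set" and f :: "'a set \<Rightarrow> int" and key :: "'a \<Rightarrow> int"
  assumes finite_U: "finite U" and submod: "submodular_on U f" and inj_key: "inj_on key U"
begin

definition below :: "'a \<Rightarrow> 'a set" where
  "below v = {w \<in> U. key w < key v}"

text \<open>Edmonds' greedy vector for the order given by \<open>key\<close>; it is a subgradient of
  the Lovasz extension at every point whose coordinates do not increase along this order.\<close>

definition marginal :: "'a \<Rightarrow> int" where
  "marginal v = f (insert v (below v)) - f (below v)"

text \<open>Diminishing returns: the rest of the set lies below its largest element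
  \<open>x\<close>, so by submodularity adding \<open>x\<close> to that rest gains at least as much
  as adding it to all of \<open>below x\<close>.\<close>

lemma sum_marginal_le:
  assumes "S \<subseteq> U"
  shows "sum marginal S \<le> f S - f {}"
proof -
  have "finite S" using assms finite_U by (rule finite_subset)
  then show ?thesis using assms
  proof (induction S rule: finite_ranking_induct[where f = key])
    case (insert x S)
    show ?case
    proof (cases "x \<in> S")
      case False
      have S: "S \<subseteq> below x"
        using insert.prems insert.hyps(2) False inj_key
        unfolding below_def inj_on_def by (force simp: order.strict_iff_order)
      have "insert x S \<union> below x = insert x (below x)" "insert x S \<inter> below x = S"
        using S by (auto simp: below_def)
      then have "f (insert x (below x)) + f S \<le> f (insert x S) + f (below x)"
        using submod[unfolded submodular_on_def, rule_format, of "insert x S" "below x"] insert.prems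
        by (simp add: below_def)
      then have "marginal x \<le> f (insert x S) - f S"
        by (simp add: marginal_def)
      moreover have "sum marginal S \<le> f S - f {}"
        using insert by blast
      ultimately show ?thesis using insert.hyps(1) False by simp
    qed (use insert in \<open>simp add: insert_absorb\<close>)
  qed simp
qed

text \<open>For an initial segment the sum telescopes, because what precedes the largest element is
  exactly the rest of the segment.\<close>

lemma sum_marginal_eq:
  assumes "L \<subseteq> U" "\<And>v w. v \<in> L \<Longrightarrow> w \<in> U \<Longrightarrow> key w < key v \<Longrightarrow> w \<in> L"
  shows "sum marginal L = f L - f {}"
proof -
  have "finite L" using assms(1) finite_U by (rule finite_subset)
  then show ?thesis using assms
  proof (induction L rule: finite_ranking_induct[where f = key])
    case (insert x L)
    show ?case
    proof (cases "x \<in> L")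
      case False
      have "L \<subseteq> below x"
        using insert.prems insert.hyps(2) False inj_key
        unfolding below_def inj_on_def by (force simp: order.strict_iff_order)
      moreover have "below x \<subseteq> L"
        using insert.prems(2)[of x] by (auto simp: below_def)
      ultimately have "below x = L" by blast
      then have "marginal x = f (insert x L) - f L"
        by (simp add: marginal_def)
      moreover have "sum marginal L = f L - f {}"
      proof (rule insert.IH)
        fix v w
        assume "v \<in> L" "w \<in> U" "key w < key v"
        then show "w \<in> L"
          using insert.prems(2)[of v w] insert.hyps(2)[of v] by auto
      qed (use insert.prems in auto)
      ultimately show ?thesis using insert.hyps(1) False by simp
    qed (use insert in \<open>simp add: insert_absorb\<close>)
  qed simp
qed

text \<open>One projected subgradient step on the Lovasz extension of \<open>f\<close>, scaled to the cube
  \<open>{0..N}^U\<close>: as long as no level set of \<open>y\<close> is optimal, the squared distance to the vertex of the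
  cube which belongs to a minimizer \<open>S\<close> decreases by at least \<open>N\<close>.\<close>

lemma subgradient_step:
  fixes y :: "'a \<Rightarrow> int"
  assumes y: "\<And>v. v \<in> U \<Longrightarrow> 0 \<le> y v \<and> y v \<le> N"
    and key: "\<And>v w. v \<in> U \<Longrightarrow> w \<in> U \<Longrightarrow> key w < key v \<Longrightarrow> y v \<le> y w"
    and S: "S \<subseteq> U"
    and level: "\<And>j. 0 \<le> j \<Longrightarrow> j < N \<Longrightarrow> f S < f {v \<in> U. j < y v}"
    and G: "\<And>v. v \<in> U \<Longrightarrow> \<bar>marginal v\<bar> \<le> G" and N: "int (card U) * G\<^sup>2 \<le> N" "0 \<le> N"
  defines "opt \<equiv> \<lambda>v. if v \<in> S then N else 0"
  shows "(\<Sum>v\<in>U. (max 0 (min N (y v - marginal v)) - opt v)\<^sup>2) \<le> (\<Sum>v\<in>U. (y v - opt v)\<^sup>2) - N"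
proof -
  let ?g = marginal
  have clamp: "(max 0 (min N a) - opt v)\<^sup>2 \<le> (a - opt v)\<^sup>2" for a v
  proof -
    have "\<bar>max 0 (min N a) - opt v\<bar> \<le> \<bar>a - opt v\<bar>"
      using N(2) by (auto simp: opt_def)
    then show ?thesis by (simp add: abs_le_square_iff)
  qed
  have y_count: "y v = (\<Sum>j\<in>{0..<N}. if j < y v then 1 else 0)" if "v \<in> U" for v
  proof -
    have "{0..<N} \<inter> {j. j < y v} = {0..<y v}" using y[OF that] by auto
    then show ?thesis using y[OF that] by (simp add: sum.If_cases)
  qed
  \<comment> \<open>Layer-cake decomposition: the scalar product is a sum over the levels
    \<open>j\<close>, and each level set is an initial segment of the order, on which the greedy
    vector sums to the value of \<open>f\<close>.\<close>
  have "(\<Sum>v\<in>U. ?g v * y v) = (\<Sum>v\<in>U. \<Sum>j\<in>{0..<N}. if j < y v then ?g v else 0)"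
  proof (rule sum.cong[OF refl])
    fix v
    assume "v \<in> U"
    then have "?g v * y v = ?g v * (\<Sum>j\<in>{0..<N}. if j < y v then 1 else 0)"
      using y_count by metis
    also have "\<dots> = (\<Sum>j\<in>{0..<N}. if j < y v then ?g v else 0)"
      unfolding sum_distrib_left by (rule sum.cong) auto
    finally show "?g v * y v = (\<Sum>j\<in>{0..<N}. if j < y v then ?g v else 0)" .
  qed
  also have "\<dots> = (\<Sum>j\<in>{0..<N}. \<Sum>v\<in>U. if j < y v then ?g v else 0)"
    by (rule sum.swap)
  also have "\<dots> = (\<Sum>j\<in>{0..<N}. sum ?g {v \<in> U. j < y v})"
    by (simp add: sum.inter_filter finite_U)
  also have "\<dots> = (\<Sum>j\<in>{0..<N}. f {v \<in> U. j < y v} - f {})"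
  proof (rule sum.cong[OF refl])
    fix j
    show "sum ?g {v \<in> U. j < y v} = f {v \<in> U. j < y v} - f {}"
      by (rule sum_marginal_eq) (use key in force)+
  qed
  \<comment> \<open>Integrality enters here: a level set that is not optimal is worse by at least
    1.\<close>
  also have "\<dots> \<ge> (\<Sum>j\<in>{0..<N}. f S + 1 - f {})"
  proof (rule sum_mono)
    fix j
    assume "j \<in> {0..<N}"
    then show "f S + 1 - f {} \<le> f {v \<in> U. j < y v} - f {}" using level[of j] by simp
  qed
  finally have 1: "(\<Sum>v\<in>U. ?g v * y v) \<ge> N * (f S + 1 - f {})"
    using N(2) by simp
  have "(\<Sum>v\<in>U. ?g v * opt v) = (\<Sum>v\<in>S. ?g v * N)"
    using S finite_U by (intro sum.mono_neutral_cong_right) (auto simp: opt_def)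
  also have "\<dots> = N * sum ?g S"
    by (simp add: sum_distrib_left mult.commute)
  also have "\<dots> \<le> N * (f S - f {})"
    using sum_marginal_le[OF S] N(2) by (rule mult_left_mono)
  finally have 2: "(\<Sum>v\<in>U. ?g v * opt v) \<le> N * (f S - f {})" .
  have "(\<Sum>v\<in>U. (?g v)\<^sup>2) \<le> (\<Sum>v\<in>U. G\<^sup>2)"
  proof (rule sum_mono)
    fix v
    assume "v \<in> U"
    then show "(?g v)\<^sup>2 \<le> G\<^sup>2" using G[of v] by (simp flip: abs_le_square_iff)
  qed
  then have 3: "(\<Sum>v\<in>U. (?g v)\<^sup>2) \<le> N" using N(1) by simp
  have "(\<Sum>v\<in>U. (max 0 (min N (y v - ?g v)) - opt v)\<^sup>2) \<le> (\<Sum>v\<in>U. (y v - ?g v - opt v)\<^sup>2)"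
    by (intro sum_mono clamp)
  also have "\<dots> = (\<Sum>v\<in>U. (y v - opt v)\<^sup>2 - 2 * (?g v * y v) + 2 * (?g v * opt v) + (?g v)\<^sup>2)"
    by (intro sum.cong refl) (simp add: power2_eq_square algebra_simps)
  also have "\<dots> = (\<Sum>v\<in>U. (y v - opt v)\<^sup>2) - 2 * (\<Sum>v\<in>U. ?g v * y v) + 2 * (\<Sum>v\<in>U. ?g v * opt v) + (\<Sum>v\<in>U. (?g v)\<^sup>2)"
    by (simp add: sum.distrib sum_subtractf sum_distrib_left)
  \<comment> \<open>The scalar product of the greedy vector with \<open>y - opt\<close> is at least
    \<open>N\<close> by facts 1 and 2, so the cross terms gain \<open>2 * N\<close>, of which the
    squared length of the step takes back at most \<open>N\<close>.\<close>
  also have "\<dots> \<le> (\<Sum>v\<in>U. (y v - opt v)\<^sup>2) - N"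
    using 1 2 3 by (simp add: algebra_simps)
  finally show ?thesis .
qed

end

section \<open>Projected subgradient descent\<close>

context
  fixes U :: "'a set" and f :: "'a set \<Rightarrow> int" and idx :: "'a \<Rightarrow> int" and N G :: int
  assumes finite_U: "finite U" and submod: "submodular_on U f"
    and inj_idx: "inj_on idx U" and idx: "\<And>v. v \<in> U \<Longrightarrow> 0 \<le> idx v \<and> idx v < int (card U)"
    and G: "\<And>A v. A \<subseteq> U \<Longrightarrow> v \<in> U \<Longrightarrow> \<bar>f (insert v A) - f A\<bar> \<le> G"
    and N: "int (card U) * G\<^sup>2 \<le> N" "0 < N"
begin

text \<open>Orders by decreasing \<open>y\<close>, ties being broken by the index.\<close>

definition ykey :: "('a \<Rightarrow> int) \<Rightarrow> 'a \<Rightarrow> int" where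
  "ykey y v = idx v - int (card U) * y v"

fun iterate :: "nat \<Rightarrow> 'a \<Rightarrow> int" where
  "iterate 0 = (\<lambda>v. 0)"
| "iterate (Suc t) = (\<lambda>v. max 0 (min N (iterate t v - marginal U f (ykey (iterate t)) v)))"

text \<open>Two indices differ by less than \<open>card U\<close>, which cannot outweigh a
  difference of 1 in \<open>y\<close>.\<close>

lemma ykey_less:
  assumes "v \<in> U" "w \<in> U" "ykey y w < ykey y v"
  shows "y v \<le> y w"
proof (rule ccontr)
  assume "\<not> y v \<le> y w"
  then have "int (card U) * (y v - y w) \<ge> int (card U) * 1"
    by (intro mult_left_mono) auto
  then show False using assms idx[of v] idx[of w] by (simp add: ykey_def algebra_simps)
qed

lemma inj_ykey: "inj_on (ykey y) U"
proof (rule inj_onI)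
  fix v w
  assume vw: "v \<in> U" "w \<in> U" and eq: "ykey y v = ykey y w"
  have "idx v - idx w = int (card U) * (y v - y w)"
    using eq by (simp add: ykey_def algebra_simps)
  moreover have "\<bar>idx v - idx w\<bar> < int (card U)"
    using idx[OF vw(1)] idx[OF vw(2)] by auto
  ultimately have "idx v - idx w = 0"
    using zdvd_not_zless[of "\<bar>idx v - idx w\<bar>" "int (card U)"] by (metis abs_ge_zero dvd_abs_iff dvd_triv_left order_le_less abs_eq_0_iff)
  then show "v = w" using inj_idx vw by (simp add: inj_on_def)
qed

lemma iterate_bounds: "0 \<le> iterate t v" "iterate t v \<le> N"
  using N by (cases t; simp)+

text \<open>The squared distance to the optimal vertex starts at no more than
  \<open>card U * N * N\<close> and is never negative. If no level set were optimal, each step would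
  lower it by \<open>N\<close>, which can happen at most \<open>card U * N\<close> times.\<close>

theorem level_set_optimal:
  "\<exists>t \<le> card U * nat N. \<exists>j. 0 \<le> j \<and> j < N \<and> (\<forall>A \<subseteq> U. f {v \<in> U. j < iterate t v} \<le> f A)"
proof -
  obtain S where S: "S \<subseteq> U" "\<And>A. A \<subseteq> U \<Longrightarrow> f S \<le> f A"
    using exists_minimizer[OF finite_U, of f] by blast
  let ?D = "\<lambda>t. \<Sum>v\<in>U. (iterate t v - (if v \<in> S then N else 0))\<^sup>2"
  show ?thesis
  proof (rule ccontr)
    assume neg: "\<not> ?thesis"
    have *: "f S < f {v \<in> U. j < iterate t v}" if jt: "0 \<le> j" "j < N" "t \<le> card U * nat N" for j t
    proof -
      obtain A where "A \<subseteq> U" "f A < f {v \<in> U. j < iterate t v}"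
        using neg jt by (metis not_le)
      then show ?thesis using S(2)[of A] by simp
    qed
    have D: "?D t \<le> ?D 0 - int t * N" if "t \<le> Suc (card U * nat N)" for t
      using that
    proof (induction t)
      case (Suc t)
      have "?D (Suc t) \<le> ?D t - N"
        unfolding iterate.simps
      proof (rule subgradient_step[OF finite_U submod inj_ykey])
        show "\<bar>marginal U f (ykey (iterate t)) v\<bar> \<le> G" if "v \<in> U" for v
          unfolding marginal_def[OF finite_U submod inj_ykey] below_def[OF finite_U submod inj_ykey]
          by (rule G) (use that in auto)
      qed (use Suc.prems S N iterate_bounds ykey_less * in auto)
      then show ?case using Suc by (simp add: algebra_simps)
    qed simp
    have "?D 0 \<le> (\<Sum>v\<in>U. N\<^sup>2)"
      by (rule sum_mono) auto
    then have "?D 0 \<le> int (card U) * N * N"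
      by (simp add: power2_eq_square)
    moreover have "0 \<le> ?D (Suc (card U * nat N))"
      by (intro sum_nonneg) simp
    ultimately have "int (Suc (card U * nat N)) * N \<le> int (card U) * N * N"
      using D[of "Suc (card U * nat N)"] by linarith
    then show False using N(2) by (simp add: algebra_simps)
  qed
qed

end

section \<open>The descent on lists\<close>

lemma in_set_enumerated_iff: "(x, i) \<in> set (enumerated xs) \<longleftrightarrow> (\<exists>n < length xs. x = xs ! n \<and> i = int n)"
  by (auto simp: enumerated_eq in_set_zip)

lemma map_fst_enumerated [simp]: "map fst (enumerated xs) = xs"
  by (simp add: enumerated_eq)

lemma length_enumerated [simp]: "length (enumerated xs) = length xs"
  by (simp add: enumerated_eq)

definition argmin :: "('a \<Rightarrow> int) \<Rightarrow> 'a \<Rightarrow> 'a list \<Rightarrow> 'a" where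
  "argmin F d cs = foldl (\<lambda>b c. if F c < F b then c else b) d cs"

lemma argmin_in: "argmin F d cs \<in> insert d (set cs)"
  unfolding argmin_def by (induction cs arbitrary: d) auto

lemma argmin_le: "c \<in> insert d (set cs) \<Longrightarrow> F (argmin F d cs) \<le> F c"
proof -
  have "F (foldl (\<lambda>b c. if F c < F b then c else b) d cs) \<le> F d \<and>
      (\<forall>c\<in>set cs. F (foldl (\<lambda>b c. if F c < F b then c else b) d cs) \<le> F c)"
  proof (induction cs arbitrary: d)
    case (Cons c cs)
    from Cons[of "if F c < F d then c else d"] show ?case by auto
  qed simp
  then show "c \<in> insert d (set cs) \<Longrightarrow> ?thesis" unfolding argmin_def by auto
qed

text \<open>The vertices are listed with their indices, and a point of the cube is a list of such pairs,
  each with its coordinate.\<close>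

type_synonym 'a point = "(('a \<times> int) \<times> int) list"

text \<open>A lookup by summation: in the points that occur, exactly one entry matches.\<close>

definition coordinate :: "'a point \<Rightarrow> 'a \<times> int \<Rightarrow> int" where
  "coordinate zs p = sum_list (map snd (filter (\<lambda>z. fst (fst z) = fst p) zs))"

definition ranked_below :: "int \<Rightarrow> 'a point \<Rightarrow> ('a \<times> int) \<times> int \<Rightarrow> 'a list" where
  "ranked_below n zs z =
    map (\<lambda>w. fst (fst w)) (filter (\<lambda>w. snd (fst w) - n * snd w < snd (fst z) - n * snd z) zs)"

definition descend :: "('a list \<Rightarrow> int) \<Rightarrow> int \<Rightarrow> ('a \<times> int) list \<Rightarrow> 'a point \<Rightarrow> 'a point" where
  "descend F N ps zs = map (\<lambda>p. (p,
     let y = coordinate zs p; A = ranked_below (int (length ps)) zs (p, y)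
     in max 0 (min N (y - (F (fst p # A) - F A))))) ps"

definition level_list :: "int \<Rightarrow> 'a point \<Rightarrow> 'a list" where
  "level_list j zs = map (\<lambda>z. fst (fst z)) (filter (\<lambda>z. j < snd z) zs)"

text \<open>The whole history is kept, latest point first, because only some iterate is known to
  have an optimal level set, not necessarily the last.\<close>

definition points :: "('a list \<Rightarrow> int) \<Rightarrow> int \<Rightarrow> ('a \<times> int) list \<Rightarrow> 'a point list" where
  "points F N ps = foldl (\<lambda>acc _. descend F N ps (head_or [] acc) # acc) [map (\<lambda>p. (p, 0)) ps]
     (units (int (length ps) * N))"

text \<open>The side \<open>N\<close> of the cube is at least the squared length of any greedy
  vector whose entries are bounded by \<open>G\<close>; the \<open>+ 1\<close> keeps it positive.
  \<open>enumerated (units N)\<close> supplies the levels from 0 to \<open>N - 1\<close>.\<close>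

definition sfm :: "('a list \<Rightarrow> int) \<Rightarrow> 'a list \<Rightarrow> int \<Rightarrow> 'a list" where
  "sfm F us G = (let ps = enumerated us; N = int (length us) * (G * G) + 1 in
     argmin F [] (concat (map (\<lambda>zs. map (\<lambda>j. level_list (snd j) zs) (enumerated (units N)))
       (points F N ps))))"

lemma foldl_history:
  assumes "\<And>t. state (Suc t) = g (state t)"
  shows "foldl (\<lambda>acc _. g (head_or d acc) # acc) [state 0] us = rev (map state [0..<Suc (length us)])"
  using assms by (induction us rule: rev_induct) (auto simp: head_or_def)

context
  fixes us :: "'a list" and F :: "'a list \<Rightarrow> int" and f :: "'a set \<Rightarrow> int" and G :: int
  assumes distinct_us: "distinct us"
    and F: "\<And>xs. distinct xs \<Longrightarrow> set xs \<subseteq> set us \<Longrightarrow> F xs = f (set xs)"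
    and submod: "submodular_on (set us) f"
    and G: "\<And>A v. A \<subseteq> set us \<Longrightarrow> v \<in> set us \<Longrightarrow> \<bar>f (insert v A) - f A\<bar> \<le> G"
begin

private definition "idx v = the (map_of (enumerated us) v)"
private definition "N = int (length us) * (G * G) + 1"
private definition "it = iterate (set us) f idx N"

private lemma distinct_fst: "distinct (map fst (enumerated us))"
  using distinct_us by simp

private lemma idx_eq: "p \<in> set (enumerated us) \<Longrightarrow> snd p = idx (fst p)"
  using distinct_fst unfolding idx_def by (metis map_of_eq_Some_iff option.sel prod.collapse)

private lemma fst_enumerated: "fst ` set (enumerated us) = set us"
  by (metis list.set_map map_fst_enumerated)

private lemma card_us: "card (set us) = length us"
  using distinct_us by (rule distinct_card)

private lemma idx_nth: "n < length us \<Longrightarrow> idx (us ! n) = int n"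
  using idx_eq[of "(us ! n, int n)"] by (auto simp: in_set_enumerated_iff)

private lemma iterate_facts:
  "finite (set us)" "inj_on idx (set us)"
  "\<And>v. v \<in> set us \<Longrightarrow> 0 \<le> idx v \<and> idx v < int (card (set us))"
  "int (card (set us)) * G\<^sup>2 \<le> N" "0 < N"
  unfolding card_us
  by (auto simp: in_set_conv_nth idx_nth inj_on_def N_def power2_eq_square add_nonneg_pos)

private lemmas it_defs =
  iterate.simps[OF iterate_facts(1) submod iterate_facts(2,3) G iterate_facts(4,5)]
  marginal_def[OF iterate_facts(1) submod inj_ykey[OF iterate_facts(1) submod iterate_facts(2,3) G iterate_facts(4,5)]]

private lemma set_filter_fst: "set (map fst (filter (\<lambda>p. R (fst p)) (enumerated us))) = {v \<in> set us. R v}"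
  unfolding fst_enumerated[symmetric] by auto

private lemma point_below:
  fixes y :: "'a \<Rightarrow> int"
  assumes p: "p \<in> set (enumerated us)"
  defines "A \<equiv> ranked_below (int (length us)) (map (\<lambda>p. (p, y (fst p))) (enumerated us)) (p, y (fst p))"
  shows "distinct A" "set A = {w \<in> set us. idx w - int (length us) * y w < idx (fst p) - int (length us) * y (fst p)}"
proof -
  let ?Q = "\<lambda>w. snd w - int (length us) * y (fst w) < snd p - int (length us) * y (fst p)"
  have A: "A = map fst (filter ?Q (enumerated us))"
    unfolding A_def ranked_below_def by (simp add: filter_map o_def)
  show "distinct A"
    unfolding A using distinct_fst by (rule distinct_map_filter)
  show "set A = {w \<in> set us. idx w - int (length us) * y w < idx (fst p) - int (length us) * y (fst p)}"
  proof -
    have "filter ?Q (enumerated us) = filter (\<lambda>w. idx (fst w) - int (length us) * y (fst w) <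
        idx (fst p) - int (length us) * y (fst p)) (enumerated us)"
      by (rule filter_cong) (simp_all add: idx_eq p)
    with set_filter_fst[of "\<lambda>v. idx v - int (length us) * y v < idx (fst p) - int (length us) * y (fst p)"]
    show ?thesis unfolding A by metis
  qed
qed

private lemma descend_point:
  "descend F N (enumerated us) (map (\<lambda>p. (p, it t (fst p))) (enumerated us)) =
    map (\<lambda>p. (p, it (Suc t) (fst p))) (enumerated us)"
  unfolding descend_def
proof (rule map_cong[OF refl])
  fix p
  assume p: "p \<in> set (enumerated us)"
  let ?zs = "map (\<lambda>p. (p, it t (fst p))) (enumerated us)"
  have "filter (\<lambda>q. fst q = fst p) (enumerated us) = [p]"
  proof -
    have "distinct (map fst xs) \<Longrightarrow> p \<in> set xs \<Longrightarrow> filter (\<lambda>q. fst q = fst p) xs = [p]" for xs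
      by (induction xs) (force simp: filter_empty_conv)+
    then show ?thesis using distinct_fst p by blast
  qed
  then have y: "coordinate ?zs p = it t (fst p)"
    by (simp add: coordinate_def filter_map o_def)
  let ?A = "ranked_below (int (length us)) ?zs (p, it t (fst p))"
  have A: "distinct ?A" "set ?A = below (set us) (ykey (set us) idx (it t)) (fst p)"
    using point_below[OF p, of "it t"]
    by (simp_all add: below_def[OF iterate_facts(1) submod inj_ykey[OF iterate_facts(1) submod iterate_facts(2,3) G iterate_facts(4,5)]]
      ykey_def[OF iterate_facts(1) submod iterate_facts(2,3) G iterate_facts(4,5)] card_us)
  have "fst p \<in> set us" using p fst_enumerated by blast
  \<comment> \<open>\<open>F\<close> is tied to \<open>f\<close> on distinct lists only, so
    \<open>fst p # ?A\<close> must not repeat a vertex.\<close>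
  moreover have "fst p \<notin> set ?A" using point_below(2)[OF p, of "it t"] by auto
  moreover have "set ?A \<subseteq> set us" using point_below(2)[OF p, of "it t"] by auto
  ultimately have "F (fst p # ?A) = f (insert (fst p) (set ?A))" "F ?A = f (set ?A)"
    using F[of "fst p # ?A"] F[of ?A] A(1) by auto
  then show "(p, let y = coordinate ?zs p; A = ranked_below (int (length (enumerated us))) ?zs (p, y)
      in max 0 (min N (y - (F (fst p # A) - F A)))) = (p, it (Suc t) (fst p))"
    unfolding y Let_def length_enumerated A(2) by (simp add: it_def it_defs A(2))
qed

theorem sfm_correct:
  "set (sfm F us G) \<subseteq> set us" "distinct (sfm F us G)"
  "A \<subseteq> set us \<Longrightarrow> f (set (sfm F us G)) \<le> f A"
proof -
  let ?state = "\<lambda>t. map (\<lambda>p. (p, it t (fst p))) (enumerated us)"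
  have points: "points F N (enumerated us) = rev (map ?state [0..<Suc (nat (int (length us) * N))])"
  proof -
    have 0: "?state 0 = map (\<lambda>p. (p, 0)) (enumerated us)"
      by (simp add: it_def it_defs)
    have "foldl (\<lambda>acc _. descend F N (enumerated us) (head_or [] acc) # acc) [?state 0]
        (units (int (length us) * N)) = rev (map ?state [0..<Suc (length (units (int (length us) * N)))])"
      by (rule foldl_history[of ?state "descend F N (enumerated us)"]) (rule descend_point[symmetric])
    then show ?thesis by (simp only: points_def 0 length_enumerated length_units)
  qed
  define cs where "cs = concat (map (\<lambda>zs. map (\<lambda>j. level_list (snd j) zs) (enumerated (units N)))
    (points F N (enumerated us)))"
  have sfm: "sfm F us G = argmin F [] cs"
    by (simp add: sfm_def cs_def N_def Let_def)
  have level: "set (level_list j (?state t)) = {v \<in> set us. j < it t v}"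
    "distinct (level_list j (?state t))" for j t
  proof -
    have *: "level_list j (?state t) = map fst (filter (\<lambda>p. j < it t (fst p)) (enumerated us))"
      by (simp add: level_list_def filter_map o_def)
    show "set (level_list j (?state t)) = {v \<in> set us. j < it t v}"
      unfolding * by (rule set_filter_fst[of "\<lambda>v. j < it t v"])
    show "distinct (level_list j (?state t))"
      unfolding * using distinct_fst by (rule distinct_map_filter)
  qed
  have cs: "set xs \<subseteq> set us \<and> distinct xs" if "xs \<in> insert [] (set cs)" for xs
    using that level unfolding cs_def points by auto
  then show 1: "set (sfm F us G) \<subseteq> set us" "distinct (sfm F us G)"
    using argmin_in[of F "[]" cs] unfolding sfm by blast+
  obtain t j where tj: "t \<le> card (set us) * nat N" "0 \<le> j" "j < N"
    "\<And>A. A \<subseteq> set us \<Longrightarrow> f {v \<in> set us. j < it t v} \<le> f A"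
    using level_set_optimal[OF iterate_facts(1) submod iterate_facts(2,3) G iterate_facts(4,5)] unfolding it_def by metis
  assume A: "A \<subseteq> set us"
  have "level_list j (?state t) \<in> set cs"
  proof -
    have "t < Suc (nat (int (length us) * N))"
      using tj(1) by (simp add: card_us nat_mult_distrib)
    then have "?state t \<in> set (points F N (enumerated us))"
      unfolding points by (auto simp del: upt_Suc)
    moreover have "((), j) \<in> set (enumerated (units N))"
      using tj by (auto simp: in_set_enumerated_iff intro!: exI[of _ "nat j"])
    ultimately show ?thesis unfolding cs_def by force
  qed
  then have "F (sfm F us G) \<le> F (level_list j (?state t))"
    unfolding sfm by (intro argmin_le) simp
  then have "f (set (sfm F us G)) \<le> f {v \<in> set us. j < it t v}"
    using F[OF 1(2,1)] F[OF level(2)[of j t]] level(1)[of j t] by auto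
  also have "\<dots> \<le> f A" by (rule tj(4)[OF A])
  finally show "f (set (sfm F us G)) \<le> f A" .
qed

end

section \<open>Submodular minimization is polynomial\<close>

lemmas fp_arith = fp_plus fp_minus fp_uminus fp_times fp_le fp_less fp_max fp_min fp_length fp_sum_list fp_units
lemmas fp_lists = fp_rev fp_append fp_map fp_filter fp_concat fp_enumerated fp_list_ex fp_eq_nat fp_member
lemmas fp_intros = fp_basic fp_arith fp_lists

lemma fp_argmin:
  assumes F: "fp (\<lambda>p. F (fst p) (snd p))" and "fp d" "fp l"
  shows "fp (\<lambda>x. argmin (F x) (d x) (l x))"
  unfolding argmin_def
proof (rule fp_foldl_elem[where g = snd and k = 0])
  show "fp (\<lambda>p. if F (fst p) (snd (snd p)) < F (fst p) (fst (snd p)) then snd (snd p) else fst (snd p))"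
    by (intro fp_intros fp_comp2[OF F])
qed (auto intro: assms fp_basic)

lemma fp_coordinate:
  fixes zs :: "'e::encodable \<Rightarrow> nat point"
  shows "fp zs \<Longrightarrow> fp p \<Longrightarrow> fp (\<lambda>x. coordinate (zs x) (p x))"
  unfolding coordinate_def by (intro fp_intros; (rule fp_comp, assumption)?; intro fp_intros)

lemma fp_ranked_below:
  fixes zs :: "'e::encodable \<Rightarrow> nat point"
  assumes "fp n" "fp zs" "fp z"
  shows "fp (\<lambda>x. ranked_below (n x) (zs x) (z x))"
  unfolding ranked_below_def
  by (intro fp_intros assms fp_comp[OF assms(1)] fp_comp[OF assms(2)] fp_comp[OF assms(3)])

lemma fp_level_list:
  fixes zs :: "'e::encodable \<Rightarrow> nat point"
  assumes "fp j" "fp zs"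
  shows "fp (\<lambda>x. level_list (j x) (zs x))"
  unfolding level_list_def by (intro fp_intros assms fp_comp[OF assms(1)] fp_comp[OF assms(2)])

lemma esize_map_le:
  assumes "\<And>p. esize (h p) \<le> K"
  shows "esize (map (\<lambda>p. (p, h p)) ps) \<le> esize ps + length ps * Suc K"
proof (induction ps)
  case (Cons p ps)
  then show ?case using assms[of p] by simp
qed simp

lemma fp_points:
  fixes F :: "'e::encodable \<Rightarrow> nat list \<Rightarrow> int"
  assumes F: "fp (\<lambda>p. F (fst p) (snd p))" and N: "fp N" and ps: "fp ps"
  shows "fp (\<lambda>x. points (F x) (N x) (ps x))"
  unfolding points_def
proof (rule fp_foldl[where b = "\<lambda>p. 1 + (esize (ps (fst p)) + esize (ps (fst p)) * (1 + esize (N (fst p))))"])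
  show "fp (\<lambda>p. descend (F (fst p)) (N (fst p)) (ps (fst p)) (head_or [] (fst (snd p))) # fst (snd p))"
    unfolding descend_def
    by (intro fp_intros fp_coordinate fp_ranked_below fp_comp2[OF F] fp_comp[OF N] fp_comp[OF ps])
  show "poly_bounded (\<lambda>p. 1 + (esize (ps (fst p)) + esize (ps (fst p)) * (1 + esize (N (fst p)))))"
    by (intro poly_bounded_intros fp_esize fp_comp[OF N] fp_comp[OF ps] fp_basic)
  show "esize (descend (F x) (N x) (ps x) (head_or [] a) # a) \<le>
      esize a + (1 + (esize (ps (fst (x, y))) + esize (ps (fst (x, y))) * (1 + esize (N (fst (x, y))))))"
    for x a and y :: unit
  proof -
    \<comment> \<open>The projection onto the cube bounds every new coordinate by \<open>N\<close>,
      whatever the previous point was; this makes the growth independent of the accumulator.\<close>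
    have "esize (descend (F x) (N x) (ps x) (head_or [] a)) \<le>
        esize (ps x) + length (ps x) * Suc (esize (N x))"
      unfolding descend_def Let_def by (rule esize_map_le) (simp add: esize_int)
    also have "\<dots> \<le> esize (ps x) + esize (ps x) * Suc (esize (N x))"
      by (intro add_left_mono mult_le_mono1) (rule length_le_esize)
    finally show ?thesis by simp
  qed
qed (intro fp_intros N ps)+

theorem fp_sfm:
  fixes F :: "'e::encodable \<Rightarrow> nat list \<Rightarrow> int"
  assumes F: "fp (\<lambda>p. F (fst p) (snd p))" and us: "fp us" and G: "fp G"
  shows "fp (\<lambda>x. sfm (F x) (us x) (G x))"
  unfolding sfm_def
  by (intro fp_intros fp_argmin fp_level_list fp_points fp_comp2[OF F] fp_comp[OF us] fp_comp[OF G] F us G)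

section \<open>Partitions of minimum cost\<close>

definition intersecting_submodular :: "('a set \<Rightarrow> int) \<Rightarrow> bool" where
  "intersecting_submodular c \<longleftrightarrow> (\<forall>A B. A \<inter> B \<noteq> {} \<longrightarrow> c (A \<union> B) + c (A \<inter> B) \<le> c A + c B)"

lemma intersecting_submodularD:
  "intersecting_submodular c \<Longrightarrow> A \<inter> B \<noteq> {} \<Longrightarrow> c (A \<union> B) + c (A \<inter> B) \<le> c A + c B"
  by (simp add: intersecting_submodular_def)

text \<open>A potential \<open>x\<close> below the cost together with a partition into tight sets: by weak duality the
  partition has minimum cost.\<close>

definition tight_partition :: "('a set \<Rightarrow> int) \<Rightarrow> 'a set \<Rightarrow> ('a \<Rightarrow> int) \<Rightarrow> 'a set set \<Rightarrow> bool" where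
  "tight_partition c W x P \<longleftrightarrow> partition_on W P \<and> (\<forall>A \<subseteq> W. A \<noteq> {} \<longrightarrow> sum x A \<le> c A) \<and>
    (\<forall>Y \<in> P. sum x Y = c Y)"

lemma sum_partition:
  assumes "finite W" "partition_on W P"
  shows "sum x W = (\<Sum>Y\<in>P. sum x Y)"
proof -
  have "\<Union>P = W" "\<forall>A\<in>P. \<forall>B\<in>P. A \<noteq> B \<longrightarrow> A \<inter> B = {}"
    using assms(2) by (auto simp: partition_on_def disjoint_def)
  moreover have "\<forall>A\<in>P. finite A"
    using calculation(1) assms(1) by (auto intro: finite_subset)
  ultimately show ?thesis
    using sum.Union_disjoint[of P x] by simp
qed

lemma card_partition_le:
  assumes "finite W" "partition_on W P"
  shows "card P \<le> card W"
proof -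
  have P: "finite P" using assms finite_elements by blast
  have "(\<Sum>Y\<in>P. 1) \<le> (\<Sum>Y\<in>P. card Y)"
  proof (rule sum_mono)
    fix Y
    assume "Y \<in> P"
    then have "Y \<noteq> {}" "finite Y"
      using assms by (auto simp: partition_on_def intro: finite_subset)
    then show "1 \<le> card Y" by (simp add: Suc_le_eq card_gt_0_iff)
  qed
  then show ?thesis using sum_partition[OF assms, of "\<lambda>_. 1 :: nat"] by simp
qed

text \<open>Weak duality, stated for subsets \<open>Z\<close> as well, because one potential will be
  evaluated on several sets at once.\<close>

lemma tight_partition_le:
  assumes "finite W" "tight_partition c W x P" "Z \<subseteq> W" "partition_on Z Q"
  shows "sum x Z \<le> sum c Q"
proof -
  have "sum x Z = (\<Sum>Y\<in>Q. sum x Y)"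
    using assms by (intro sum_partition) (auto intro: finite_subset)
  also have "\<dots> \<le> sum c Q"
  proof (rule sum_mono)
    fix Y
    assume "Y \<in> Q"
    then have "Y \<subseteq> W" "Y \<noteq> {}"
      using assms(3,4) by (auto simp: partition_on_def)
    then show "sum x Y \<le> c Y"
      using assms(2) by (simp add: tight_partition_def)
  qed
  finally show ?thesis .
qed

lemma tight_partition_eq:
  assumes "finite W" "tight_partition c W x P"
  shows "sum c P = sum x W"
  using assms sum_partition[of W P x] by (simp add: tight_partition_def)

text \<open>The new vertex receives the largest value that keeps the potential below the cost; it is
  attained at \<open>X\<close>, so \<open>insert v X\<close> becomes tight. Tight sets that meet
  have a tight union, hence the old blocks that meet \<open>X\<close> merge with it into one tight
  block.\<close>

lemma tight_partition_insert:
  assumes c: "intersecting_submodular c" and W: "finite W" "v \<notin> W" and P: "tight_partition c W x P"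
    and X: "X \<subseteq> W" "\<And>A. A \<subseteq> W \<Longrightarrow> c (insert v X) - sum x X \<le> c (insert v A) - sum x A"
  defines "Q \<equiv> {Y \<in> P. Y \<inter> X \<noteq> {}}"
  shows "tight_partition c (insert v W) (x(v := c (insert v X) - sum x X))
    (insert (insert v (\<Union>Q)) (P - Q))"
proof -
  define x' where "x' = x(v := c (insert v X) - sum x X)"
  have part: "\<Union>P = W" "disjoint P" "{} \<notin> P"
    using P by (auto simp: tight_partition_def partition_on_def)
  have old: "sum x' A = sum x A" if "A \<subseteq> W" for A
    using that W(2) by (intro sum.cong) (auto simp: x'_def)
  have new: "sum x' (insert v A) = c (insert v X) - sum x X + sum x A" if "A \<subseteq> W" for A
    using that W old[OF that] by (subst sum.insert) (auto simp: x'_def intro: finite_subset)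
  have feasible: "sum x' A \<le> c A" if A: "A \<subseteq> insert v W" "A \<noteq> {}" for A
  proof (cases "v \<in> A")
    case True
    then have "A = insert v (A - {v})" "A - {v} \<subseteq> W" using A by auto
    then show ?thesis using new[of "A - {v}"] X(2)[of "A - {v}"] by simp
  next
    case False
    then have "A \<subseteq> W" using A by blast
    then show ?thesis using A P old[of A] by (simp add: tight_partition_def)
  qed
  have "finite Q"
    using P W(1) finite_elements unfolding Q_def tight_partition_def by fastforce
  moreover have "Q \<subseteq> {Y \<in> P. Y \<inter> X \<noteq> {}}" by (simp add: Q_def)
  ultimately have "sum x' (insert v X \<union> \<Union>Q) = c (insert v X \<union> \<Union>Q)"
  proof (induction Q)
    case empty
    then show ?case using new[OF X(1)] by simp
  next
    case (insert Y Q)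
    let ?A = "insert v X \<union> \<Union>Q"
    have Y: "Y \<in> P" "Y \<inter> X \<noteq> {}" and Q: "\<Union>Q \<subseteq> W" and YW: "Y \<subseteq> W"
      using insert.prems part(1) by blast+
    have sub: "?A \<subseteq> insert v W" using X(1) Q by auto
    have fin: "finite ?A" "finite Y"
      using sub YW W(1) by (auto intro: finite_subset)
    \<comment> \<open>Uncrossing: both sets are tight and the potential stays below the cost on
      their nonempty intersection, so the submodular inequality leaves no slack on the
      union.\<close>
    have meet: "?A \<inter> Y \<noteq> {}" using Y by blast
    with c have "c (?A \<union> Y) + c (?A \<inter> Y) \<le> c ?A + c Y"
      by (rule intersecting_submodularD)
    also have "c ?A = sum x' ?A" using insert by simp
    also have "c Y = sum x' Y"
      using P Y(1) old[OF YW] by (simp add: tight_partition_def)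
    also have "sum x' ?A + sum x' Y = sum x' (?A \<union> Y) + sum x' (?A \<inter> Y)"
      using fin by (rule sum.union_inter[symmetric])
    finally have "c (?A \<union> Y) \<le> sum x' (?A \<union> Y)"
      using feasible[OF _ meet] sub by (simp add: le_infI1)
    moreover have "sum x' (?A \<union> Y) \<le> c (?A \<union> Y)"
      using sub YW by (intro feasible) auto
    ultimately show ?case by (simp add: Un_commute Un_left_commute)
  qed
  moreover have "insert v X \<union> \<Union>Q = insert v (\<Union>Q)"
    using X(1) part(1) unfolding Q_def by blast
  ultimately have "sum x' (insert v (\<Union>Q)) = c (insert v (\<Union>Q))" by simp
  moreover have "sum x' Y = c Y" if "Y \<in> P" for Y
    using that P part(1) old[of Y] by (auto simp: tight_partition_def)
  moreover have "partition_on (insert v W) (insert (insert v (\<Union>Q)) (P - Q))"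
    unfolding partition_on_def
  proof (intro conjI)
    show "\<Union>(insert (insert v (\<Union>Q)) (P - Q)) = insert v W"
    proof -
      have "\<Union>Q \<union> \<Union>(P - Q) = \<Union>P" unfolding Q_def by auto
      then show ?thesis using part(1) by simp
    qed
    have "disjnt (insert v (\<Union>Q)) Y" if Y: "Y \<in> P - Q" for Y
    proof -
      have "v \<notin> Y" using Y part(1) W(2) by auto
      moreover have "disjnt Z Y" if "Z \<in> Q" for Z
      proof -
        have "Z \<in> P" "Z \<noteq> Y" using that Y by (auto simp: Q_def)
        then show ?thesis using part(2) Y by (simp add: pairwiseD)
      qed
      ultimately show ?thesis by (auto simp: disjnt_iff)
    qed
    moreover have "disjoint (P - Q)" using part(2) by (rule pairwise_subset) auto
    ultimately show "disjoint (insert (insert v (\<Union>Q)) (P - Q))"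
      by (simp add: pairwise_insert disjnt_sym)
  qed (use part in auto)
  ultimately show ?thesis
    using feasible unfolding tight_partition_def x'_def by auto
qed

text \<open>The greedy procedure may start from any tight situation and never revises a value, so
  optimality on the initial set is preserved.\<close>

lemma tight_partition_extend:
  assumes c: "intersecting_submodular c" and "finite D" "finite W" "D \<inter> W = {}" "tight_partition c W x P"
  shows "\<exists>x' P'. tight_partition c (W \<union> D) x' P' \<and> (\<forall>v \<in> W. x' v = x v)"
  using assms(2-)
proof (induction D)
  case (insert v D)
  then obtain x' P' where x': "tight_partition c (W \<union> D) x' P'" "\<forall>w \<in> W. x' w = x w"
    by auto
  let ?g = "\<lambda>A. c (insert v A) - sum x' A"
  obtain X where X: "X \<subseteq> W \<union> D" "\<And>A. A \<subseteq> W \<union> D \<Longrightarrow> ?g X \<le> ?g A"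
    using exists_minimizer[of "W \<union> D" ?g] insert by blast
  have v: "v \<notin> W \<union> D" "finite (W \<union> D)" using insert by auto
  from tight_partition_insert[OF c v(2,1) x'(1) X]
  have "\<exists>P''. tight_partition c (W \<union> insert v D) (x'(v := c (insert v X) - sum x' X)) P''"
    by auto
  moreover have "\<forall>w \<in> W. (x'(v := c (insert v X) - sum x' X)) w = x w"
    using x'(2) v(1) by auto
  ultimately show ?case by blast
qed auto

section \<open>Submodularity of the Dilworth truncation\<close>

definition min_partition_cost :: "('a set \<Rightarrow> int) \<Rightarrow> 'a set \<Rightarrow> int" where
  "min_partition_cost c Z = Min (sum c ` {P. partition_on Z P})"

lemma finite_partitions: "finite Z \<Longrightarrow> finite {P. partition_on Z P}"
  by (rule finite_subset[of _ "Pow (Pow Z)"]) (auto simp: partition_on_def)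

lemma min_partition_cost_le:
  "finite Z \<Longrightarrow> partition_on Z P \<Longrightarrow> min_partition_cost c Z \<le> sum c P"
  unfolding min_partition_cost_def using finite_partitions by (intro Min_le) auto

lemma min_partition_cost_tight:
  assumes "finite W" "tight_partition c W x P"
  shows "min_partition_cost c W = sum x W"
  unfolding min_partition_cost_def
proof (rule Min_eqI)
  show "finite (sum c ` {P. partition_on W P})" using assms finite_partitions by blast
  show "sum x W \<le> y" if "y \<in> sum c ` {P. partition_on W P}" for y
    using that tight_partition_le[OF assms order_refl] by auto
  show "sum x W \<in> sum c ` {P. partition_on W P}"
    using assms tight_partition_eq[OF assms] by (force simp: tight_partition_def)
qed

lemma min_partition_cost_ge:
  assumes "finite W" "tight_partition c W x P" "Z \<subseteq> W"
  shows "sum x Z \<le> min_partition_cost c Z"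
proof -
  have Z: "finite Z" using assms(1,3) by (rule rev_finite_subset)
  have "{P. partition_on Z P} \<noteq> {}"
    using partition_on_space[of Z] partition_on_empty[of "{}"] by (cases "Z = {}") auto
  with Z show ?thesis
    unfolding min_partition_cost_def using tight_partition_le[OF assms] finite_partitions[OF Z]
    by (subst Min_ge_iff) auto
qed

text \<open>The greedy potential can be made optimal for two nested sets at once.\<close>

lemma min_partition_cost_submodular:
  assumes c: "intersecting_submodular c" and fin: "finite A" "finite B"
  shows "min_partition_cost c (A \<union> B) + min_partition_cost c (A \<inter> B) \<le>
    min_partition_cost c A + min_partition_cost c B"
proof -
  have "tight_partition c {} (\<lambda>_. 0) {}"
    by (simp add: tight_partition_def partition_on_def)
  from tight_partition_extend[OF c _ _ _ this, of "A \<inter> B"] fin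
  obtain x P where x: "tight_partition c (A \<inter> B) x P" by auto
  from tight_partition_extend[OF c _ _ _ x, of "(A \<union> B) - (A \<inter> B)"] fin
  obtain x' P' where "tight_partition c (A \<inter> B \<union> ((A \<union> B) - A \<inter> B)) x' P'" "\<forall>v\<in>A \<inter> B. x' v = x v"
    by auto
  moreover have "A \<inter> B \<union> ((A \<union> B) - A \<inter> B) = A \<union> B" by auto
  ultimately have x': "tight_partition c (A \<union> B) x' P'" and eq: "\<forall>v\<in>A \<inter> B. x' v = x v"
    by simp_all
  have "min_partition_cost c (A \<inter> B) = sum x' (A \<inter> B)"
    using min_partition_cost_tight[OF _ x] fin eq by simp
  moreover have "min_partition_cost c (A \<union> B) = sum x' (A \<union> B)"
    using min_partition_cost_tight[OF _ x'] fin by simp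
  \<comment> \<open>For \<open>A\<close> and \<open>B\<close> themselves feasibility of the
    potential suffices: they stand on the larger side, and the potential is modular.\<close>
  moreover have "sum x' A \<le> min_partition_cost c A" "sum x' B \<le> min_partition_cost c B"
    using min_partition_cost_ge[OF _ x'] fin by auto
  moreover have "sum x' (A \<union> B) + sum x' (A \<inter> B) = sum x' A + sum x' B"
    using fin by (rule sum.union_inter)
  ultimately show ?thesis by simp
qed

section \<open>The greedy algorithm\<close>

definition weight :: "('a \<times> int) list \<Rightarrow> 'a set \<Rightarrow> int" where
  "weight xs A = sum_list (map snd (filter (\<lambda>z. fst z \<in> A) xs))"

lemma weight_eq_sum: "finite A \<Longrightarrow> weight xs A = (\<Sum>v\<in>A. weight xs {v})"
proof (induction xs)
  case (Cons z xs)
  have "(\<Sum>v\<in>A. weight (z # xs) {v}) = (\<Sum>v\<in>A. (if v = fst z then snd z else 0) + weight xs {v})"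
    by (rule sum.cong) (auto simp: weight_def)
  also have "\<dots> = (if fst z \<in> A then snd z else 0) + weight xs A"
    using Cons by (simp add: sum.distrib)
  finally show ?case by (simp add: weight_def)
qed (simp add: weight_def)

text \<open>The state holds the blocks and the potential as an association list. On correct inputs
  the clamp to \<open>[-G, G]\<close> never takes effect; it bounds the size of the new entry for
  arbitrary states, as the loop rule demands.\<close>

definition greedy_step ::
  "('a list \<Rightarrow> int) \<Rightarrow> int \<Rightarrow> 'a list list \<times> ('a \<times> int) list \<Rightarrow> 'a \<Rightarrow> 'a list list \<times> ('a \<times> int) list" where
  "greedy_step C G st v = (let
     X = v # sfm (\<lambda>A. C (v # A) - weight (snd st) (set A)) (map fst (snd st)) G;
     a = max (- G) (min G (C X - weight (snd st) (set X)))
   in ((v # concat (filter (\<lambda>Y. \<exists>u\<in>set Y. u \<in> set X) (fst st)))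
     # filter (\<lambda>Y. \<not> (\<exists>u\<in>set Y. u \<in> set X)) (fst st), (v, a) # snd st))"

definition blocks :: "('a list \<Rightarrow> int) \<Rightarrow> int \<Rightarrow> 'a list \<Rightarrow> 'a list list" where
  "blocks C G Z = fst (foldl (greedy_step C G) ([], []) Z)"

lemma distinct_concat_sets:
  "distinct (concat Bs) \<Longrightarrow> [] \<notin> set Bs \<Longrightarrow> distinct (map set Bs)"
proof (induction Bs)
  case (Cons Y Bs)
  have "set Y \<notin> set ` set Bs"
  proof
    assume "set Y \<in> set ` set Bs"
    then have "set Y \<subseteq> set (concat Bs)" by auto
    moreover have "set Y \<inter> set (concat Bs) = {}" "set Y \<noteq> {}"
      using Cons.prems by auto
    ultimately show False by (simp only: Int_absorb2)
  qed
  then show ?case using Cons.IH Cons.prems by simp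
qed simp

context
  fixes C :: "'a list \<Rightarrow> int" and c :: "'a set \<Rightarrow> int" and L G :: int and n :: nat
  assumes c: "intersecting_submodular c"
    and C: "\<And>xs. distinct xs \<Longrightarrow> xs \<noteq> [] \<Longrightarrow> C xs = c (set xs)"
    and L: "\<And>A. A \<noteq> {} \<Longrightarrow> \<bar>c A\<bar> \<le> L"
    and G: "2 * (int n + 1) * L \<le> G"
begin

private definition greedy_inv :: "'a list \<Rightarrow> 'a list list \<times> ('a \<times> int) list \<Rightarrow> bool" where
  "greedy_inv Z st \<longleftrightarrow> distinct (map fst (snd st)) \<and> set (map fst (snd st)) = set Z \<and>
    distinct (concat (fst st)) \<and> [] \<notin> set (fst st) \<and>
    tight_partition c (set Z) (\<lambda>v. weight (snd st) {v}) (set ` set (fst st)) \<and>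
    (\<forall>v \<in> set Z. \<bar>weight (snd st) {v}\<bar> \<le> 2 * int n * L)"

private lemma L_nonneg: "0 \<le> L"
  using L[OF UNIV_not_empty] by linarith

text \<open>The total potential is the cost of at most \<open>n\<close> blocks, each at most
  \<open>L\<close> in absolute value.\<close>

private lemma abs_sum_tight:
  assumes "finite W" "card W \<le> n" "tight_partition c W x P"
  shows "\<bar>sum x W\<bar> \<le> int n * L"
proof -
  have P: "partition_on W P" using assms(3) by (simp add: tight_partition_def)
  have "\<bar>sum x W\<bar> = \<bar>sum c P\<bar>"
    using tight_partition_eq[OF assms(1,3)] by simp
  also have "\<dots> \<le> (\<Sum>Y\<in>P. \<bar>c Y\<bar>)" by (rule sum_abs)
  also have "\<dots> \<le> (\<Sum>Y\<in>P. L)"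
    using P by (intro sum_mono L) (auto simp: partition_on_def)
  also have "\<dots> = int (card P) * L" by simp
  also have "\<dots> \<le> int n * L"
    using card_partition_le[OF assms(1) P] assms(2) L_nonneg by (intro mult_right_mono) auto
  finally show ?thesis .
qed

private lemma greedy_step_inv:
  assumes inv: "greedy_inv Z st" and v: "v \<notin> set Z" and len: "card (insert v (set Z)) \<le> n"
  shows "greedy_inv (Z @ [v]) (greedy_step C G st v)"
proof -
  obtain B xs where st: "st = (B, xs)" by force
  define x where "x = (\<lambda>v. weight xs {v})"
  let ?W = "set Z"
  have dxs: "distinct (map fst xs)" and sxs: "set (map fst xs) = ?W"
    and dB: "distinct (concat B)" and nB: "[] \<notin> set B"
    and tight: "tight_partition c ?W x (set ` set B)"
    and bound: "\<And>u. u \<in> ?W \<Longrightarrow> \<bar>x u\<bar> \<le> 2 * int n * L"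
    using inv by (auto simp: greedy_inv_def st x_def)
  have weight: "weight xs A = sum x A" if "finite A" for A
    using weight_eq_sum[OF that] by (simp add: x_def)
  \<comment> \<open>A vertex without an entry weighs 0, so it does not matter below that
    \<open>v\<close> itself is contained in the set being weighed.\<close>
  have xv: "x v = 0"
  proof -
    have "filter (\<lambda>z. fst z \<in> {v}) xs = []"
      using v sxs by (force simp: filter_empty_conv)
    then show ?thesis by (simp add: x_def weight_def)
  qed
  define f where "f = (\<lambda>A. c (insert v A) - sum x A)"
  define S where "S = sfm (\<lambda>A. C (v # A) - weight xs (set A)) (map fst xs) G"
  have f_submod: "submodular_on ?W f"
    unfolding submodular_on_def
  proof (intro allI impI)
    fix A B
    assume AB: "A \<subseteq> ?W" "B \<subseteq> ?W"
    then have fin: "finite A" "finite B" by (auto intro: finite_subset)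
    have "c (insert v A \<union> insert v B) + c (insert v A \<inter> insert v B) \<le> c (insert v A) + c (insert v B)"
      by (intro intersecting_submodularD c) auto
    moreover have "insert v A \<union> insert v B = insert v (A \<union> B)" "insert v A \<inter> insert v B = insert v (A \<inter> B)"
      by auto
    ultimately show "f (A \<union> B) + f (A \<inter> B) \<le> f A + f B"
      using sum.union_inter[OF fin, of x] unfolding f_def by simp
  qed
  have f_G: "\<bar>f (insert u A) - f A\<bar> \<le> G" if "A \<subseteq> ?W" "u \<in> ?W" for A u
  proof -
    have fin: "finite A" using that(1) by (rule finite_subset) simp
    have "\<bar>sum x (insert u A) - sum x A\<bar> \<le> 2 * int n * L"
      using bound[OF that(2)] L_nonneg fin by (cases "u \<in> A") (auto simp: insert_absorb)
    moreover have "\<bar>c (insert v (insert u A))\<bar> \<le> L" "\<bar>c (insert v A)\<bar> \<le> L"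
      by (auto intro: L)
    \<comment> \<open>The two values of \<open>c\<close> contribute \<open>2 * L\<close> and the
      potential of \<open>u\<close> at most \<open>2 * int n * L\<close>: this is where the bound
      required of \<open>G\<close> comes from.\<close>
    ultimately have "\<bar>f (insert u A) - f A\<bar> \<le> 2 * int n * L + 2 * L"
      unfolding f_def by linarith
    also have "\<dots> = 2 * (int n + 1) * L" by (simp add: algebra_simps)
    finally show ?thesis using G by linarith
  qed
  have S: "set S \<subseteq> ?W" "distinct S" and S_min: "\<And>A. A \<subseteq> ?W \<Longrightarrow> f (set S) \<le> f A"
  proof -
    have F: "C (v # ys) - weight xs (set ys) = f (set ys)"
      if "distinct ys" "set ys \<subseteq> set (map fst xs)" for ys
      using that v sxs C[of "v # ys"] weight[of "set ys"] by (auto simp: f_def)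
    note sfm = sfm_correct[OF dxs F _ f_G, unfolded sxs, OF _ _ f_submod, folded S_def]
    show "set S \<subseteq> ?W" "distinct S" "\<And>A. A \<subseteq> ?W \<Longrightarrow> f (set S) \<le> f A"
      using sfm sxs by auto
  qed
  define x' where "x' = x(v := c (insert v (set S)) - sum x (set S))"
  let ?Q = "{Y \<in> set ` set B. Y \<inter> set S \<noteq> {}}"
  let ?P' = "insert (insert v (\<Union>?Q)) (set ` set B - ?Q)"
  have tight': "tight_partition c (insert v ?W) x' ?P'"
    unfolding x'_def
    by (rule tight_partition_insert[OF c _ v tight S(1)]) (use S_min in \<open>simp_all add: f_def\<close>)
  \<comment> \<open>The value of \<open>v\<close> is a difference of two total potentials, each at
    most \<open>int n * L\<close> in absolute value.\<close>
  have x'v: "x' v = sum x' (insert v ?W) - sum x ?W"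
    using v by (subst sum.insert) (auto simp: x'_def intro!: sum.cong)
  have "\<bar>sum x' (insert v ?W)\<bar> \<le> int n * L"
    using len by (intro abs_sum_tight[OF _ _ tight']) auto
  moreover have "\<bar>sum x ?W\<bar> \<le> int n * L"
    using len v by (intro abs_sum_tight[OF _ _ tight]) auto
  ultimately have bound_v: "\<bar>x' v\<bar> \<le> 2 * int n * L"
    unfolding x'v by linarith
  also have "\<dots> \<le> 2 * (int n + 1) * L"
    using L_nonneg by (intro mult_right_mono) auto
  finally have G_v: "\<bar>x' v\<bar> \<le> G" using G by linarith
  have "C (v # S) - weight xs (set (v # S)) = x' v"
  proof -
    have vS: "v \<notin> set S" using S(1) v by blast
    then have "C (v # S) = c (insert v (set S))" using C[of "v # S"] S(2) by simp
    moreover have "weight xs (set (v # S)) = sum x (set S)"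
      using vS weight[of "insert v (set S)"] xv by simp
    ultimately show ?thesis by (simp add: x'_def)
  qed
  then have clamp: "max (- G) (min G (C (v # S) - weight xs (set (v # S)))) = x' v"
    using G_v by auto
  let ?meets = "\<lambda>Y. \<exists>u\<in>set Y. u \<in> set (v # S)"
  have step: "greedy_step C G st v = ((v # concat (filter ?meets B)) # filter (\<lambda>Y. \<not> ?meets Y) B, (v, x' v) # xs)"
    using clamp unfolding greedy_step_def st S_def Let_def by simp
  have UB: "\<Union>(set ` set B) = ?W"
    using tight by (simp add: tight_partition_def partition_on_def)
  have meets: "?meets Y \<longleftrightarrow> set Y \<inter> set S \<noteq> {}" if "Y \<in> set B" for Y
    using that UB v by auto
  have sets: "set ` set (fst (greedy_step C G st v)) = ?P'"
  proof -
    have eq: "filter ?meets B = filter (\<lambda>Y. set Y \<inter> set S \<noteq> {}) B"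
      "filter (\<lambda>Y. \<not> ?meets Y) B = filter (\<lambda>Y. \<not> set Y \<inter> set S \<noteq> {}) B"
      using meets by (auto intro!: filter_cong simp del: set_simps)
    have "\<Union>?Q = set (concat (filter (\<lambda>Y. set Y \<inter> set S \<noteq> {}) B))"
      by auto
    moreover have "set ` set B - ?Q = set ` set (filter (\<lambda>Y. \<not> set Y \<inter> set S \<noteq> {}) B)"
      by auto
    moreover have "fst (greedy_step C G st v) = (v # concat (filter (\<lambda>Y. set Y \<inter> set S \<noteq> {}) B)) #
        filter (\<lambda>Y. \<not> set Y \<inter> set S \<noteq> {}) B"
      unfolding step eq by simp
    ultimately show ?thesis by (simp only: list.set image_insert)
  qed
  have x'_weight: "weight ((v, x' v) # xs) {u} = x' u" for u
    using xv unfolding x'_def x_def weight_def by auto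
  have "distinct (concat (filter R B) @ concat (filter (\<lambda>Y. \<not> R Y) B))" for R
    using dB by (induction B) auto
  then have "distinct (concat (filter ?meets B) @ concat (filter (\<lambda>Y. \<not> ?meets Y) B))" .
  then have dist: "distinct (concat (fst (greedy_step C G st v)))"
    unfolding step using UB v by auto
  have bound': "\<bar>x' u\<bar> \<le> 2 * int n * L" if "u \<in> insert v ?W" for u
    using that bound[of u] bound_v by (cases "u = v") (auto simp: x'_def)
  show ?thesis
    unfolding greedy_inv_def sets using dist dxs sxs v nB tight' bound'
    unfolding step by (simp add: x'_weight insert_commute)
qed

private lemma greedy_inv_foldl:
  "distinct Z \<Longrightarrow> length Z \<le> n \<Longrightarrow> greedy_inv Z (foldl (greedy_step C G) ([], []) Z)"
proof (induction Z rule: rev_induct)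
  case Nil
  show ?case by (simp add: greedy_inv_def tight_partition_def partition_on_def)
next
  case (snoc v Z)
  then show ?case
    using greedy_step_inv[of Z "foldl (greedy_step C G) ([], []) Z" v]
    by (simp add: card_insert_if distinct_card)
qed

theorem blocks_correct:
  assumes "distinct Z" "length Z \<le> n"
  shows "distinct (concat (blocks C G Z))" "[] \<notin> set (blocks C G Z)"
    "partition_on (set Z) (set ` set (blocks C G Z))"
    "sum_list (map C (blocks C G Z)) = min_partition_cost c (set Z)"
    "\<bar>min_partition_cost c (set Z)\<bar> \<le> int n * L"
proof -
  let ?B = "blocks C G Z"
  let ?x = "\<lambda>v. weight (snd (foldl (greedy_step C G) ([], []) Z)) {v}"
  have inv: "greedy_inv Z (foldl (greedy_step C G) ([], []) Z)"
    using greedy_inv_foldl[OF assms] .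
  then show B: "distinct (concat ?B)" "[] \<notin> set ?B"
    and P: "partition_on (set Z) (set ` set ?B)"
    by (auto simp: greedy_inv_def blocks_def tight_partition_def)
  have tight: "tight_partition c (set Z) ?x (set ` set ?B)"
    using inv by (simp add: greedy_inv_def blocks_def)
  have dist: "distinct (map set ?B)"
    using B by (rule distinct_concat_sets)
  have "sum_list (map C ?B) = sum_list (map (\<lambda>Y. c (set Y)) ?B)"
    using B C by (intro arg_cong[of _ _ sum_list] map_cong) (auto simp: distinct_concat_iff)
  also have "\<dots> = sum_list (map c (map set ?B))" by (simp add: o_def)
  also have "\<dots> = sum c (set ` set ?B)"
    using dist by (simp only: sum_list_distinct_conv_sum_set set_map)
  finally show "sum_list (map C ?B) = min_partition_cost c (set Z)"
    using tight_partition_eq[OF _ tight] min_partition_cost_tight[OF _ tight] by simp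
  show "\<bar>min_partition_cost c (set Z)\<bar> \<le> int n * L"
    using min_partition_cost_tight[OF _ tight] abs_sum_tight[OF _ _ tight] assms
    by (simp add: distinct_card)
qed

end

section \<open>Running time of the greedy algorithm\<close>

lemma fp_weight:
  fixes xs :: "'e::encodable \<Rightarrow> (nat \<times> int) list"
  assumes "fp xs" "fp A"
  shows "fp (\<lambda>x. weight (xs x) (set (A x)))"
  unfolding weight_def by (intro fp_intros assms fp_comp[OF assms(1)] fp_comp[OF assms(2)])

text \<open>Merging blocks does not enlarge the data, so a greedy step adds little more than the new
  vertex and its value.\<close>

lemma esize_concat_filter:
  "esize (concat (filter P Bs)) + esize (filter (\<lambda>Y. \<not> P Y) Bs) \<le> esize Bs"
  by (induction Bs) (auto simp: esize_append)

lemma esize_greedy_step: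
  "esize (greedy_step C G st v) \<le> esize st + (4 + 2 * esize v + esize G)"
proof -
  obtain B xs where st: "st = (B, xs)" by force
  \<comment> \<open>Only the shape of the result matters for its size; which blocks are merged and
    which value is clamped stays open.\<close>
  have "\<exists>P b. greedy_step C G st v = ((v # concat (filter P B)) # filter (\<lambda>Y. \<not> P Y) B,
      (v, max (- G) (min G b)) # xs)"
    unfolding greedy_step_def st Let_def fst_conv snd_conv by (intro exI) (rule refl)
  then obtain P b where eq: "greedy_step C G st v =
      ((v # concat (filter P B)) # filter (\<lambda>Y. \<not> P Y) B, (v, max (- G) (min G b)) # xs)"
    by blast
  have "esize (max (- G) (min G b)) \<le> esize G"
    by (auto simp: esize_int)
  then show ?thesis
    using esize_concat_filter[of P B] unfolding eq by (simp add: st)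
qed

lemma fp_blocks:
  fixes C :: "'e::encodable \<Rightarrow> nat list \<Rightarrow> int"
  assumes C: "fp (\<lambda>p. C (fst p) (snd p))" and G: "fp G" and Z: "fp Z"
  shows "fp (\<lambda>x. blocks (C x) (G x) (Z x))"
proof -
  have "fp (\<lambda>x. foldl (greedy_step (C x) (G x)) ([], []) (Z x))"
  proof (rule fp_foldl[where b = "\<lambda>p. 4 + 2 * esize (snd p) + esize (G (fst p))"])
    show "fp (\<lambda>p. greedy_step (C (fst p)) (G (fst p)) (fst (snd p)) (snd (snd p)))"
      unfolding greedy_step_def
      by (intro fp_intros fp_sfm fp_weight fp_comp2[OF C] fp_comp[OF G])
    show "poly_bounded (\<lambda>p. 4 + 2 * esize (snd p) + esize (G (fst p)))"
      by (intro poly_bounded_intros fp_esize fp_comp[OF G] fp_basic)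
    show "esize (greedy_step (C x) (G x) st v) \<le>
        esize st + (4 + 2 * esize (snd (x, v)) + esize (G (fst (x, v))))" for x st v
      using esize_greedy_step[of "C x" "G x" st v] by simp
  qed (auto intro: Z fp_basic)
  then show ?thesis unfolding blocks_def by (rule fp_fst)
qed

section \<open>In-degrees\<close>

definition rho :: "('a \<times> 'a) list \<Rightarrow> 'a set \<Rightarrow> int" where
  "rho es A = int (length (filter (\<lambda>e. fst e \<notin> A \<and> snd e \<in> A) es))"

lemma rho_bounds: "0 \<le> rho es A" "rho es A \<le> int (length es)"
  by (simp_all add: rho_def)

lemma rho_Cons: "rho (e # es) A = (if fst e \<notin> A \<and> snd e \<in> A then 1 else 0) + rho es A"
  by (simp add: rho_def)

lemma rho_submodular: "rho es (A \<union> B) + rho es (A \<inter> B) \<le> rho es A + rho es B"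
proof (induction es)
  case (Cons e es)
  then show ?case unfolding rho_Cons by auto
qed (simp add: rho_def)

text \<open>An arc can enter only a member that contains its head, and disjointness leaves at most
  one such member.\<close>

lemma sum_rho_le:
  assumes "finite \<Y>" "disjoint \<Y>"
  shows "(\<Sum>Y\<in>\<Y>. rho es Y) \<le> int (length es)"
proof (induction es)
  case (Cons e es)
  have "(\<Sum>Y\<in>\<Y>. if fst e \<notin> Y \<and> snd e \<in> Y then 1 else (0 :: int)) \<le> (\<Sum>Y\<in>\<Y>. if snd e \<in> Y then 1 else 0)"
    by (rule sum_mono) auto
  also have "\<dots> = int (card {Y \<in> \<Y>. snd e \<in> Y})"
    using assms(1) by (simp add: sum.If_cases Int_def)
  also have "\<dots> \<le> 1"
  proof -
    have "Y = Z" if "Y \<in> {Y \<in> \<Y>. snd e \<in> Y}" "Z \<in> {Y \<in> \<Y>. snd e \<in> Y}" for Y Z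
      using that assms(2) by (auto simp: disjoint_def)
    then have "card {Y \<in> \<Y>. snd e \<in> Y} \<le> Suc 0"
      using assms(1) by (intro card_le_Suc0_iff_eq[THEN iffD2]) auto
    then show ?thesis by simp
  qed
  finally show ?case using Cons unfolding rho_Cons by (simp add: sum.distrib)
qed (simp add: rho_def)

lemma fp_rho:
  fixes es :: "'e::encodable \<Rightarrow> (nat \<times> nat) list"
  assumes "fp es" "fp A"
  shows "fp (\<lambda>x. rho (es x) (set (A x)))"
  unfolding rho_def by (intro fp_intros assms fp_comp[OF assms(1)] fp_comp[OF assms(2)])

text \<open>A subpartition in which \<open>s\<close> is covered is turned into a partition: an uncovered vertex becomes
  a singleton of cost \<open>0\<close>. Lowering the cost of singletons keeps intersecting submodularity.\<close>

definition cost :: "('a \<times> 'a) list \<Rightarrow> int \<Rightarrow> 'a \<Rightarrow> 'a set \<Rightarrow> int" where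
  "cost es k s A = (if is_singleton A \<and> s \<notin> A then min 0 (rho es A - k) else rho es A - k)"

definition block_cost :: "('a \<times> 'a) list \<Rightarrow> int \<Rightarrow> 'a \<Rightarrow> 'a list \<Rightarrow> int" where
  "block_cost es k s X = (let a = rho es (set X) - k in if tl X = [] \<and> s \<notin> set X then min 0 a else a)"

lemma tl_Nil_iff: "distinct X \<Longrightarrow> X \<noteq> [] \<Longrightarrow> tl X = [] \<longleftrightarrow> is_singleton (set X)"
  using is_singleton_altdef[of "set X"] by (cases X) (auto simp: distinct_card)

lemma block_cost_eq: "distinct X \<Longrightarrow> X \<noteq> [] \<Longrightarrow> block_cost es k s X = cost es k s (set X)"
  by (simp add: block_cost_def cost_def tl_Nil_iff Let_def)

lemma cost_le: "cost es k s A \<le> rho es A - k"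
  by (simp add: cost_def)

lemma abs_cost_le: "0 \<le> k \<Longrightarrow> \<bar>cost es k s A\<bar> \<le> int (length es) + k"
  using rho_bounds[of es A] by (auto simp: cost_def)

text \<open>A singleton that meets a set is contained in it, and for nested sets both sides agree.
  If neither set is a singleton, the lowering can affect only the smaller side of the
  inequality.\<close>

lemma intersecting_submodular_cost: "intersecting_submodular (cost es k s)"
  unfolding intersecting_submodular_def
proof (intro allI impI)
  fix A B :: "'a set"
  assume AB: "A \<inter> B \<noteq> {}"
  show "cost es k s (A \<union> B) + cost es k s (A \<inter> B) \<le> cost es k s A + cost es k s B"
  proof (cases "is_singleton A \<or> is_singleton B")
    case True
    then have "A \<subseteq> B \<or> B \<subseteq> A"
      using AB by (auto simp: is_singleton_def)
    then show ?thesis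
      by (auto simp: Un_absorb1 Un_absorb2 Int_absorb1 Int_absorb2)
  next
    case False
    then show ?thesis
      using cost_le[of es k s "A \<union> B"] cost_le[of es k s "A \<inter> B"] rho_submodular[of es A B]
      by (simp add: cost_def[of es k s A] cost_def[of es k s B])
  qed
qed

lemma fp_block_cost:
  fixes es :: "'e::encodable \<Rightarrow> (nat \<times> nat) list"
  assumes "fp es" "fp k" "fp s" "fp X"
  shows "fp (\<lambda>x. block_cost (es x) (k x) (s x) (X x))"
  unfolding block_cost_def
  by (intro fp_intros fp_rho assms fp_comp[OF assms(1)] fp_comp[OF assms(2)] fp_comp[OF assms(3)] fp_comp[OF assms(4)])

section \<open>Two prescribed vertices in different members\<close>

definition rest :: "'a list \<Rightarrow> 'a list \<Rightarrow> 'a list" where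
  "rest vs R = filter (\<lambda>v. v \<notin> set R) vs"

definition separated_cost :: "'a list \<Rightarrow> ('a \<times> 'a) list \<Rightarrow> int \<Rightarrow> int \<Rightarrow> 'a \<Rightarrow> 'a \<Rightarrow> 'a list \<Rightarrow> int" where
  "separated_cost vs es k G r s R = rho es (set (r # R)) - k +
    sum_list (map (block_cost es k s) (blocks (block_cost es k s) G (rest vs (r # R))))"

text \<open>The discarded singletons are those that the lowered cost counts with 0 instead of their
  positive true cost, so the total is unchanged. As \<open>s\<close> is kept out of
  \<open>R\<close>, it lies in a block, and that block is never discarded; together with
  \<open>R\<close> this gives two members.\<close>

definition separated_family :: "'a list \<Rightarrow> ('a \<times> 'a) list \<Rightarrow> int \<Rightarrow> int \<Rightarrow> 'a \<Rightarrow> 'a \<Rightarrow> 'a list list" where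
  "separated_family vs es k G r s = (let
     R = r # sfm (separated_cost vs es k G r s) (rest vs [r, s]) G
   in R # filter (\<lambda>Y. \<not> (tl Y = [] \<and> s \<notin> set Y \<and> 0 < rho es (set Y) - k))
     (blocks (block_cost es k s) G (rest vs R)))"

definition family_cost :: "('a \<times> 'a) list \<Rightarrow> int \<Rightarrow> 'a list list \<Rightarrow> int" where
  "family_cost es k Xs = sum_list (map (\<lambda>X. rho es (set X) - k) Xs)"

lemma set_rest: "set (rest vs R) = set vs - set R"
  by (auto simp: rest_def)

lemma sum_cost_le_subpartition:
  assumes V: "finite V" and Y: "subpartition V \<Y>" and R: "R \<in> \<Y>" and S: "S \<in> \<Y>" "s \<in> S"
  shows "rho es R - k + min_partition_cost (cost es k s) (V - R) \<le> (\<Sum>Y\<in>\<Y>. rho es Y - k)"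
proof -
  have sub: "\<And>Y. Y \<in> \<Y> \<Longrightarrow> Y \<subseteq> V \<and> Y \<noteq> {}" and dis: "disjoint \<Y>"
    using Y by (auto simp: subpartition_def)
  have fin: "finite \<Y>"
    using sub V by (intro finite_subset[of \<Y> "Pow V"]) auto
  let ?U = "(\<lambda>v. {v}) ` (V - \<Union>\<Y>)"
  have "partition_on (V - R) ((\<Y> - {R}) \<union> ?U)"
    unfolding partition_on_def
  proof (intro conjI)
    have "Y \<inter> R = {}" if "Y \<in> \<Y> - {R}" for Y
      using that R dis by (auto simp: disjoint_def)
    then have "\<Union>(\<Y> - {R}) = \<Union>\<Y> - R" using R by auto
    then show "\<Union>((\<Y> - {R}) \<union> ?U) = V - R" using sub R by auto
    show "disjoint ((\<Y> - {R}) \<union> ?U)"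
      using dis by (auto simp: disjoint_def)
    show "{} \<notin> (\<Y> - {R}) \<union> ?U" using sub by auto
  qed
  then have "min_partition_cost (cost es k s) (V - R) \<le> sum (cost es k s) ((\<Y> - {R}) \<union> ?U)"
    using V by (intro min_partition_cost_le) auto
  also have "\<dots> = sum (cost es k s) (\<Y> - {R}) + sum (cost es k s) ?U"
    using fin V by (intro sum.union_disjoint) auto
  also have "sum (cost es k s) ?U \<le> 0"
    using S by (intro sum_nonpos) (auto simp: cost_def)
  also have "sum (cost es k s) (\<Y> - {R}) \<le> (\<Sum>Y\<in>\<Y> - {R}. rho es Y - k)"
    by (intro sum_mono cost_le)
  finally show ?thesis
    using sum.remove[OF fin R, of "\<lambda>Y. rho es Y - k"] by simp
qed

context
  fixes vs :: "'a list" and es :: "('a \<times> 'a) list" and k G :: int and r s :: 'a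
  assumes distinct_vs: "distinct vs" and rs: "r \<in> set vs" "s \<in> set vs" "r \<noteq> s" and k: "0 \<le> k"
    and G: "G = 2 * (int (length vs) + 1) * (int (length es) + k)"
begin

private definition "h A = rho es (insert r A) - k + min_partition_cost (cost es k s) (set vs - insert r A)"

private lemma blocks_rest:
  fixes R :: "'a list"
  defines "B \<equiv> blocks (block_cost es k s) G (rest vs R)"
  shows "distinct (concat B)" "[] \<notin> set B" "partition_on (set vs - set R) (set ` set B)"
    "sum_list (map (block_cost es k s) B) = min_partition_cost (cost es k s) (set vs - set R)"
    "\<bar>min_partition_cost (cost es k s) (set vs - set R)\<bar> \<le> int (length vs) * (int (length es) + k)"
proof -
  have 1: "2 * (int (length vs) + 1) * (int (length es) + k) \<le> G" using G by simp
  have 2: "distinct (rest vs R)" "length (rest vs R) \<le> length vs"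
    using distinct_vs by (simp_all add: rest_def)
  note * = blocks_correct[OF intersecting_submodular_cost block_cost_eq abs_cost_le[OF k] 1 2,
    unfolded set_rest]
  show "distinct (concat B)" "[] \<notin> set B" "partition_on (set vs - set R) (set ` set B)"
    "sum_list (map (block_cost es k s) B) = min_partition_cost (cost es k s) (set vs - set R)"
    "\<bar>min_partition_cost (cost es k s) (set vs - set R)\<bar> \<le> int (length vs) * (int (length es) + k)"
    unfolding B_def using * by auto
qed

text \<open>Complementation exchanges union and intersection, so the truncation is submodular as a
  function of the complement too.\<close>

private lemma h_submodular: "submodular_on U h"
  unfolding submodular_on_def
proof (intro allI impI)
  fix A B
  let ?m = "\<lambda>A. min_partition_cost (cost es k s) (set vs - insert r A)"
  have eq: "set vs - insert r (A \<inter> B) = (set vs - insert r A) \<union> (set vs - insert r B)"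
    "set vs - insert r (A \<union> B) = (set vs - insert r A) \<inter> (set vs - insert r B)"
    by auto
  have "?m (A \<inter> B) + ?m (A \<union> B) \<le> ?m A + ?m B"
    unfolding eq by (rule min_partition_cost_submodular[OF intersecting_submodular_cost]) auto
  moreover have "insert r (A \<union> B) = insert r A \<union> insert r B" "insert r (A \<inter> B) = insert r A \<inter> insert r B"
    by auto
  then have "rho es (insert r (A \<union> B)) + rho es (insert r (A \<inter> B)) \<le> rho es (insert r A) + rho es (insert r B)"
    using rho_submodular[of es "insert r A" "insert r B"] by simp
  ultimately show "h (A \<union> B) + h (A \<inter> B) \<le> h A + h B"
    unfolding h_def by linarith
qed

private lemma separated_cost_eq: "separated_cost vs es k G r s R = h (set R)"
  using blocks_rest(4)[of "r # R"] by (simp add: separated_cost_def h_def)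

text \<open>A marginal is a difference of two values, hence the factor 2. The in-degree term
  contributes \<open>m + k\<close> and the partition at most \<open>n\<close> times as much, for
  \<open>n\<close> vertices and \<open>m\<close> arcs, so the same \<open>G\<close> serves the inner
  and the outer minimization.\<close>

private lemma h_bound: "A \<subseteq> set vs \<Longrightarrow> 2 * \<bar>h A\<bar> \<le> G"
proof -
  assume "A \<subseteq> set vs"
  then have "finite A" by (rule finite_subset) simp
  then obtain R where R: "set R = A" using finite_list by blast
  have "\<bar>h A\<bar> \<le> (int (length es) + k) + int (length vs) * (int (length es) + k)"
    using blocks_rest(5)[of "r # R"] rho_bounds[of es "insert r A"] k R
    unfolding h_def by simp
  then show ?thesis unfolding G by (simp add: algebra_simps)
qed

private lemma sfm_rest:
  defines "X \<equiv> sfm (separated_cost vs es k G r s) (rest vs [r, s]) G"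
  shows "set X \<subseteq> set vs - {r, s}" "distinct X" "A \<subseteq> set vs - {r, s} \<Longrightarrow> h (set X) \<le> h A"
proof -
  have "\<bar>h (insert v A) - h A\<bar> \<le> G" if "A \<subseteq> set vs - {r, s}" "v \<in> set vs - {r, s}" for A v
  proof -
    have "A \<subseteq> set vs" "insert v A \<subseteq> set vs" using that by auto
    from this[THEN h_bound] show ?thesis by linarith
  qed
  then have "\<bar>h (insert v A) - h A\<bar> \<le> G" if "A \<subseteq> set (rest vs [r, s])" "v \<in> set (rest vs [r, s])" for A v
    using that by (simp add: set_rest)
  moreover have "distinct (rest vs [r, s])" using distinct_vs by (simp add: rest_def)
  ultimately have *: "set X \<subseteq> set (rest vs [r, s])" "distinct X"
    "\<And>A. A \<subseteq> set (rest vs [r, s]) \<Longrightarrow> h (set X) \<le> h A"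
    unfolding X_def using sfm_correct[of "rest vs [r, s]" "separated_cost vs es k G r s" h G]
      separated_cost_eq h_submodular by blast+
  have "set (rest vs [r, s]) = set vs - {r, s}" by (simp add: set_rest)
  with * show "set X \<subseteq> set vs - {r, s}" "distinct X" "A \<subseteq> set vs - {r, s} \<Longrightarrow> h (set X) \<le> h A"
    by auto
qed

theorem separated_family_correct:
  fixes \<Y> :: "'a set set"
  defines "Xs \<equiv> separated_family vs es k G r s"
  shows "distinct (concat Xs)" "[] \<notin> set Xs" "set (concat Xs) \<subseteq> set vs" "2 \<le> length Xs"
    "subpartition (set vs) \<Y> \<Longrightarrow> R \<in> \<Y> \<Longrightarrow> S \<in> \<Y> \<Longrightarrow> r \<in> R \<Longrightarrow> s \<in> S \<Longrightarrow> R \<noteq> S \<Longrightarrow>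
      family_cost es k Xs \<le> (\<Sum>Y\<in>\<Y>. rho es Y - k)"
proof -
  define X where "X = sfm (separated_cost vs es k G r s) (rest vs [r, s]) G"
  define B where "B = blocks (block_cost es k s) G (rest vs (r # X))"
  let ?P = "\<lambda>Y. \<not> (tl Y = [] \<and> s \<notin> set Y \<and> 0 < rho es (set Y) - k)"
  have Xs: "Xs = (r # X) # filter ?P B"
    unfolding Xs_def separated_family_def X_def B_def Let_def ..
  note X = sfm_rest[folded X_def] and B = blocks_rest[of "r # X", folded B_def]
  have UB: "set (concat B) = set vs - set (r # X)"
    using B(3) by (simp add: partition_on_def)
  have sub: "set (concat (filter ?P B)) \<subseteq> set (concat B)" by auto
  have "distinct (concat (filter R B))" for R
    using B(1) by (induction B) auto
  then show "distinct (concat Xs)"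
    using X sub unfolding Xs UB by auto
  show "[] \<notin> set Xs" using B(2) by (simp add: Xs)
  show "set (concat Xs) \<subseteq> set vs" using sub X rs unfolding Xs UB by auto
  have "s \<in> set (concat B)" using rs X unfolding UB by auto
  then obtain Y where "Y \<in> set B" "s \<in> set Y" by auto
  then have "Y \<in> set (filter ?P B)" by simp
  from length_pos_if_in_set[OF this] show "2 \<le> length Xs"
    unfolding Xs length_Cons by linarith
  assume \<Y>: "subpartition (set vs) \<Y>" "R \<in> \<Y>" "S \<in> \<Y>" "r \<in> R" "s \<in> S" "R \<noteq> S"
  \<comment> \<open>The filter removes exactly the blocks whose lowered cost differs from the true
    one, and there the lowered cost is 0.\<close>
  have "sum_list (map (block_cost es k s) B) = sum_list (map (\<lambda>Y. rho es (set Y) - k) (filter ?P B))"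
    by (induction B) (auto simp: block_cost_def Let_def)
  then have "family_cost es k Xs = h (set X)"
    unfolding family_cost_def Xs using B(4) by (simp add: h_def)
  also have "\<dots> \<le> h (R - {r})"
  proof (rule X(3))
    have "R \<inter> S = {}" "R \<subseteq> set vs"
      using \<Y> by (auto simp: subpartition_def disjoint_def)
    then show "R - {r} \<subseteq> set vs - {r, s}" using \<Y>(5) by auto
  qed
  also have "\<dots> \<le> (\<Sum>Y\<in>\<Y>. rho es Y - k)"
    using sum_cost_le_subpartition[OF _ \<Y>(1,2,3,5), of es k] \<Y>(4)
    unfolding h_def by (simp add: insert_absorb)
  finally show "family_cost es k Xs \<le> (\<Sum>Y\<in>\<Y>. rho es Y - k)" .
qed

end

section \<open>The algorithm\<close>

definition pair_families :: "'a list \<Rightarrow> ('a \<times> 'a) list \<Rightarrow> int \<Rightarrow> int \<Rightarrow> 'a list list list" where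
  "pair_families vs es k G =
    concat (map (\<lambda>r. map (\<lambda>s. separated_family vs es k G r s) (rest vs [r])) vs)"

definition best_family :: "'a list \<Rightarrow> ('a \<times> 'a) list \<Rightarrow> int \<Rightarrow> 'a list list" where
  "best_family vs es k = (let
     Fs = pair_families vs es k (2 * (int (length vs) + 1) * (int (length es) + k))
   in argmin (family_cost es k) (head_or [] Fs) Fs)"

text \<open>Beyond one more than the number of arcs, \<open>k\<close> no longer matters: the number of members is
  maximized first.\<close>

definition solve :: "nat list \<times> (nat \<times> nat) list \<times> nat \<Rightarrow> nat list list" where
  "solve x = (let vs = fst x; es = fst (snd x)
   in best_family vs es (capped (int (length es) + 1) (snd (snd x))))"

section \<open>Running time of the algorithm\<close>

lemma fp_rest:
  fixes vs :: "'e::encodable \<Rightarrow> nat list"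
  assumes "fp vs" "fp R"
  shows "fp (\<lambda>x. rest (vs x) (R x))"
  unfolding rest_def by (intro fp_intros assms fp_comp[OF assms(1)] fp_comp[OF assms(2)])

lemma fp_separated_cost:
  fixes vs :: "'e::encodable \<Rightarrow> nat list"
  assumes "fp vs" "fp es" "fp k" "fp G" "fp r" "fp s" "fp R"
  shows "fp (\<lambda>x. separated_cost (vs x) (es x) (k x) (G x) (r x) (s x) (R x))"
  unfolding separated_cost_def
  by (intro fp_intros fp_rho fp_blocks fp_block_cost fp_rest assms assms[THEN fp_comp])

lemma fp_separated_family:
  fixes vs :: "'e::encodable \<Rightarrow> nat list"
  assumes "fp vs" "fp es" "fp k" "fp G" "fp r" "fp s"
  shows "fp (\<lambda>x. separated_family (vs x) (es x) (k x) (G x) (r x) (s x))"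
  unfolding separated_family_def
  by (intro fp_intros fp_rho fp_blocks fp_block_cost fp_rest fp_sfm fp_separated_cost assms assms[THEN fp_comp])

lemma fp_family_cost:
  fixes es :: "'e::encodable \<Rightarrow> (nat \<times> nat) list"
  assumes "fp es" "fp k" "fp Xs"
  shows "fp (\<lambda>x. family_cost (es x) (k x) (Xs x))"
  unfolding family_cost_def by (intro fp_intros fp_rho assms assms[THEN fp_comp])

lemma fp_pair_families:
  fixes vs :: "'e::encodable \<Rightarrow> nat list"
  assumes "fp vs" "fp es" "fp k" "fp G"
  shows "fp (\<lambda>x. pair_families (vs x) (es x) (k x) (G x))"
  unfolding pair_families_def
  by (intro fp_intros fp_rest fp_separated_family assms assms[THEN fp_comp])

lemma fp_best_family:
  fixes vs :: "'e::encodable \<Rightarrow> nat list"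
  assumes "fp vs" "fp es" "fp k"
  shows "fp (\<lambda>x. best_family (vs x) (es x) (k x))"
  unfolding best_family_def
  by (intro fp_intros fp_pair_families fp_argmin fp_family_cost assms assms[THEN fp_comp])

theorem fp_solve: "fp solve"
proof -
  have "fp (\<lambda>x. solve x)"
    unfolding solve_def by (intro fp_intros fp_best_family fp_capped)
  then show ?thesis .
qed

section \<open>Correctness of the algorithm\<close>

lemma in_pair_families_iff:
  "F \<in> set (pair_families vs es k G) \<longleftrightarrow>
    (\<exists>r\<in>set vs. \<exists>s\<in>set vs. r \<noteq> s \<and> F = separated_family vs es k G r s)"
proof -
  have "set (pair_families vs es k G) =
      (\<Union>r\<in>set vs. separated_family vs es k G r ` (set vs - {r}))"
    by (simp add: pair_families_def set_rest)
  moreover have "(\<exists>s\<in>V - {r}. P s) \<longleftrightarrow> (\<exists>s\<in>V. r \<noteq> s \<and> P s)" for V :: "'a set" and r P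
    by auto
  ultimately show ?thesis by (simp only: UN_iff image_iff)
qed

text \<open>Every competitor has two members, and a vertex from each forms a pair that separates
  them; the family computed for this pair is at least as good as the competitor.\<close>

lemma best_family_correct:
  fixes vs :: "'a list" and es :: "('a \<times> 'a) list"
  assumes vs: "distinct vs" "2 \<le> length vs" and k: "0 \<le> k"
  defines "Xs \<equiv> best_family vs es k"
  shows "distinct (concat Xs)" "[] \<notin> set Xs" "set (concat Xs) \<subseteq> set vs" "2 \<le> length Xs"
    "subpartition (set vs) \<Y> \<Longrightarrow> 2 \<le> card \<Y> \<Longrightarrow> family_cost es k Xs \<le> (\<Sum>Y\<in>\<Y>. rho es Y - k)"
proof -
  let ?G = "2 * (int (length vs) + 1) * (int (length es) + k)"
  let ?fam = "\<lambda>r s. separated_family vs es k ?G r s"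
  define Fs where "Fs = pair_families vs es k ?G"
  have Fs: "F \<in> set Fs \<longleftrightarrow> (\<exists>r\<in>set vs. \<exists>s\<in>set vs. r \<noteq> s \<and> F = ?fam r s)" for F
    unfolding Fs_def by (rule in_pair_families_iff)
  have Xs: "Xs = argmin (family_cost es k) (head_or [] Fs) Fs"
    unfolding Xs_def best_family_def Fs_def Let_def ..
  \<comment> \<open>With two vertices there is at least one pair, so the default \<open>[]\<close>
    of \<open>head_or\<close> is never the starting candidate.\<close>
  obtain u v ws where "vs = u # v # ws"
    using vs(2) by (auto simp: numeral_2_eq_2 Suc_le_length_iff)
  then have "?fam u v \<in> set Fs"
    unfolding Fs using vs(1) by (intro bexI[of _ u] bexI[of _ v]) auto
  then have "head_or [] Fs \<in> set Fs"
    by (cases Fs) (auto simp: head_or_def)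
  then have "Xs \<in> set Fs"
    using argmin_in[of "family_cost es k" "head_or [] Fs" Fs] unfolding Xs by auto
  then obtain r s where "r \<in> set vs" "s \<in> set vs" "r \<noteq> s" and eq: "Xs = ?fam r s"
    unfolding Fs by blast
  note * = separated_family_correct[where es = es, OF vs(1) this(1-3) k refl, folded eq]
  show "distinct (concat Xs)" "[] \<notin> set Xs" "set (concat Xs) \<subseteq> set vs" "2 \<le> length Xs"
    by (rule *)+
  assume \<Y>: "subpartition (set vs) \<Y>" "2 \<le> card \<Y>"
  have "finite \<Y>" using \<Y>(2) by (intro card_ge_0_finite) simp
  then obtain R S where RS: "R \<in> \<Y>" "S \<in> \<Y>" "R \<noteq> S"
    using card_le_Suc0_iff_eq[of \<Y>] \<Y>(2) by auto
  have "R \<subseteq> set vs" "S \<subseteq> set vs" "R \<noteq> {}" "S \<noteq> {}" "R \<inter> S = {}"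
    using \<Y>(1) RS by (auto simp: subpartition_def disjoint_def)
  then obtain r' s' where r's': "r' \<in> R" "s' \<in> S" "r' \<in> set vs" "s' \<in> set vs" "r' \<noteq> s'"
    by blast
  then have "?fam r' s' \<in> set Fs" unfolding Fs by blast
  then have "family_cost es k Xs \<le> family_cost es k (?fam r' s')"
    unfolding Xs by (intro argmin_le) simp
  also have "\<dots> \<le> (\<Sum>Y\<in>\<Y>. rho es Y - k)"
    by (rule separated_family_correct(5)[OF vs(1) r's'(3-5) k refl \<Y>(1) RS(1,2) r's'(1,2) RS(3)])
  finally show "family_cost es k Xs \<le> (\<Sum>Y\<in>\<Y>. rho es Y - k)" .
qed

text \<open>With \<open>m\<close> arcs, the in-degrees of a disjoint family sum to a value between 0
  and \<open>m\<close>. At the cap \<open>m + 1\<close> a family with fewer members therefore cannot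
  win, so \<open>\<X>\<close> has at least as many members as \<open>\<Y>\<close>, and raising
  \<open>k\<close> beyond the cap never hurts the larger family.\<close>

lemma optimal_uncapped:
  assumes \<X>: "finite \<X>" "disjoint \<X>" and \<Y>: "finite \<Y>" "disjoint \<Y>"
    and opt: "(\<Sum>X\<in>\<X>. rho es X - min (int (length es) + 1) k) \<le> (\<Sum>Y\<in>\<Y>. rho es Y - min (int (length es) + 1) k)"
  shows "(\<Sum>Y\<in>\<Y>. k - rho es Y) \<le> (\<Sum>X\<in>\<X>. k - rho es X)"
proof -
  define m where "m = int (length es)"
  define x where "x = int (card \<X>)"
  define y where "y = int (card \<Y>)"
  define f where "f = (\<Sum>X\<in>\<X>. rho es X)"
  define g where "g = (\<Sum>Y\<in>\<Y>. rho es Y)"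
  have g: "g \<le> m" unfolding g_def m_def by (rule sum_rho_le[OF \<Y>])
  have f: "0 \<le> f" unfolding f_def by (intro sum_nonneg rho_bounds)
  have opt': "f - x * min (m + 1) k \<le> g - y * min (m + 1) k"
    using opt by (simp add: sum_subtractf f_def g_def x_def y_def m_def)
  have "y * k - g \<le> x * k - f"
  proof (cases "k \<le> m + 1")
    case True
    then show ?thesis using opt' by simp
  next
    case False
    then have *: "(y - x) * (m + 1) \<le> g - f"
      using opt' by (simp add: min_def algebra_simps)
    have "y \<le> x"
    proof (rule ccontr)
      assume "\<not> y \<le> x"
      then have "1 * (m + 1) \<le> (y - x) * (m + 1)"
        by (intro mult_right_mono) (auto simp: m_def)
      then have "m + 1 \<le> g - f" using * by simp
      then show False using f g by simp
    qed
    then have "(x - y) * (m + 1) \<le> (x - y) * k"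
      using False by (intro mult_left_mono) auto
    then show ?thesis using * by (simp add: algebra_simps)
  qed
  then show ?thesis by (simp add: sum_subtractf f_def g_def x_def y_def)
qed

text \<open>Parallel arcs are distinct in \<open>es\<close> but share their ends; \<open>rho\<close>
  counts positions in a list rather than pairs, and so counts arcs.\<close>

lemma in_deg_eq_rho:
  assumes "distinct es" "set es = arcs D"
  shows "int (in_deg D A) = rho (map (arc_to_ends D) es) A"
proof -
  have "{e \<in> arcs D. tail D e \<notin> A \<and> head D e \<in> A} = set (filter (\<lambda>e. tail D e \<notin> A \<and> head D e \<in> A) es)"
    using assms(2) by auto
  then have "in_deg D A = length (filter (\<lambda>e. tail D e \<notin> A \<and> head D e \<in> A) es)"
    unfolding in_deg_def using distinct_card[OF distinct_filter[OF assms(1)]] by simp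
  then show ?thesis
    by (simp add: rho_def filter_map arc_to_ends_def o_def)
qed

lemma solve_optimal:
  fixes D :: "(nat, nat) pre_digraph" and k :: nat
  assumes D: "2 \<le> card (verts D)" and vs: "distinct vs" "set vs = verts D"
    and es: "distinct es" "set es = arcs D"
  defines "Xs \<equiv> solve (vs, map (arc_to_ends D) es, k)"
  shows "encodes_family (set (map set Xs)) (encode Xs)" "optimal_subpartition D k (set (map set Xs))"
proof -
  define as where "as = map (arc_to_ends D) es"
  define kk where "kk = min (int (length as) + 1) (int k)"
  have Xs: "Xs = best_family vs as kk"
    by (simp add: Xs_def solve_def as_def kk_def capped_eq)
  have "2 \<le> length vs" "0 \<le> kk"
    using D vs distinct_card[of vs] by (auto simp: kk_def)
  note best = best_family_correct[where es = as, OF vs(1) this, folded Xs]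
  have dist: "distinct (map set Xs)"
    using best(1,2) by (rule distinct_concat_sets)
  have distX: "distinct X" if "X \<in> set Xs" for X
    using that best(1) by (auto simp: distinct_concat_iff)
  have "enc_list (enc_list enc_nat) Xs = encode Xs"
    by (simp add: encode_list_def encode_nat_def)
  then show "encodes_family (set (map set Xs)) (encode Xs)"
    unfolding encodes_family_def using dist distX by (intro exI[of _ Xs]) auto
  have sub: "subpartition (verts D) (set (map set Xs))"
    unfolding subpartition_def
  proof (intro conjI)
    show "\<forall>X\<in>set (map set Xs). X \<subseteq> verts D \<and> X \<noteq> {}"
      using best(2,3) vs(2) by auto
    show "disjoint (set (map set Xs))"
      using best(1) unfolding distinct_concat_iff disjoint_def by auto
  qed
  have card: "2 \<le> card (set (map set Xs))"
    using best(4) distinct_card[OF dist] by simp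
  have fin: "finite \<Y>" if "subpartition (verts D) \<Y>" for \<Y>
    using that unfolding subpartition_def vs(2)[symmetric]
    by (intro finite_subset[of \<Y> "Pow (set vs)"]) auto
  have deficiency: "deficiency D k \<Y> = (\<Sum>Y\<in>\<Y>. int k - rho as Y)" for \<Y>
    unfolding deficiency_def as_def using in_deg_eq_rho[OF es] by simp
  have cost: "family_cost as kk Xs = (\<Sum>X\<in>set (map set Xs). rho as X - kk)"
    using sum_list_distinct_conv_sum_set[OF dist, of "\<lambda>X. rho as X - kk"]
    by (simp add: family_cost_def o_def)
  show "optimal_subpartition D k (set (map set Xs))"
    unfolding optimal_subpartition_def
  proof (intro conjI allI impI sub card)
    fix \<Y>
    assume \<Y>: "subpartition (verts D) \<Y> \<and> 2 \<le> card \<Y>"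
    then have le: "family_cost as kk Xs \<le> (\<Sum>Y\<in>\<Y>. rho as Y - kk)"
      using best(5) vs(2) by simp
    have "disjoint (set (map set Xs))" "disjoint \<Y>" "finite \<Y>"
      using sub \<Y> fin by (auto simp: subpartition_def)
    then show "deficiency D k \<Y> \<le> deficiency D k (set (map set Xs))"
      unfolding deficiency using le[unfolded cost, unfolded kk_def]
      by (intro optimal_uncapped finite_set)
  qed
qed

theorem theorem7:
  shows "\<exists>(c :: com) (p :: nat poly). \<forall>(D :: (nat, nat) pre_digraph) (k :: nat) (x :: data).
    fin_digraph D \<and> card (verts D) \<ge> 2 \<and> k \<ge> 1 \<and> encodes_instance D k x \<longrightarrow>
      (\<exists>\<X> y. computes_within c x (poly p (size x)) y \<and> encodes_family \<X> y \<and>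
        optimal_subpartition D k \<X>)"
proof -
  obtain c p where cp: "\<And>s x. s 0 = encode x \<Longrightarrow>
      \<exists>t s'. exec c s t s' \<and> t \<le> poly p (esize x) \<and> s' 0 = encode (solve x)"
    using fp_solve by (rule fpE) blast
  show ?thesis
  proof (intro exI[of _ c] exI[of _ p] allI impI)
    fix D :: "(nat, nat) pre_digraph" and k :: nat and x :: data
    assume *: "fin_digraph D \<and> card (verts D) \<ge> 2 \<and> k \<ge> 1 \<and> encodes_instance D k x"
    then obtain vs es where vs: "distinct vs" "set vs = verts D" and es: "distinct es" "set es = arcs D"
      and x: "x = enc_pair (enc_list enc_nat) (enc_pair (enc_list (enc_pair enc_nat enc_nat)) enc_nat)
        (vs, map (arc_to_ends D) es, k)"
      unfolding encodes_instance_def by blast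
    let ?x = "(vs, map (arc_to_ends D) es, k)"
    \<comment> \<open>The encoding by type is the prescribed encoding of instances, so the program
      can be run on the input directly.\<close>
    have x_eq: "x = encode ?x"
      unfolding x by (simp add: encode_list_def encode_nat_def encode_prod_def)
    obtain t s' where "exec c ((\<lambda>_. Leaf)(0 := x)) t s'" "t \<le> poly p (size x)" "s' 0 = encode (solve ?x)"
      using cp[of "(\<lambda>_. Leaf)(0 := x)" ?x] by (auto simp: x_eq)
    then have "computes_within c x (poly p (size x)) (encode (solve ?x))"
      unfolding computes_within_def by metis
    with solve_optimal[OF _ vs es, of k] * show "\<exists>\<X> y. computes_within c x (poly p (size x)) y \<and>
        encodes_family \<X> y \<and> optimal_subpartition D k \<X>"
      by blast
  qed
qed

end
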